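(* Let $M$ be a non-trivial (i.e. $M\neq\{0\}$) Hilbert space contained in the Hardy space $H^2$ as a vector subspace, with inner product $\langle\cdot,\cdot\rangle_M$ and norm $\|\cdot\|_M$. Suppose that the operator $T_z$ of multiplication by the coordinate function $z$, $(T_zf)(z)=zf(z)$, is well defined on $M$ (i.e. $T_z(M)\subseteq M$) and satisfies: (i) there exists a $\delta>0$ such that $\delta\|f\|_M\le\|T_zf\|_M\le\|f\|_M$ for all $f\in M$; (ii) for each $n\in\mathbb{N}$, $T_z^{*n}T_z^{n+1}(M)\subseteq T_z(M)$, where $T_z^*$ is the adjoint of $T_z$ with respect to the inner product on $M$. Then $T_z$ acts as a weighted shift on $M$, and there exists a $b\in H^\infty$ such that $$M=\overline{bH^2}$$ (in particular $bH^2\subseteq M$), where the closure is taken in the norm of $M$, and $$\|bf\|_M\le\|f\|_2\quad\text{for all } f\in H^2.$$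
   Context: $\mathbb{D}$ is the open unit disk in $\mathbb{C}$. The Hardy space $H^2$ is the Hilbert space of all analytic functions $f(z)=\sum_{n\ge0}\alpha_nz^n$ on $\mathbb{D}$ with $\|f\|_2^2=\sum_{n\ge0}|\alpha_n|^2<\infty$. $H^\infty$ is the Banach algebra of all bounded analytic functions on $\mathbb{D}$, and for $b\in H^\infty$, $bH^2=\{bf: f\in H^2\}$. The containment of $M$ in $H^2$ is only as a vector subspace: $M$ carries its own complete inner product, and no continuity of the inclusion $M\hookrightarrow H^2$ is assumed. $\mathbb{N}=\{1,2,3,\dots\}$. A bounded operator $T$ on a Hilbert space $H$ is called a weighted shift (with weight sequence $\{w_n\}_{n=0}^\infty$) if there are an orthonormal basis $\{e_n\}_{n=0}^\infty$ of $H$ and a bounded sequence $\{w_n\}_{n=0}^\infty$ of positive numbers such that $Te_n=w_ne_{n+1}$ for all $n\ge0$. *)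

theory Defs
  imports "HOL-Complex_Analysis.Complex_Analysis" "HOL-Library.Function_Algebras"
begin

text \<open>
  A function on the open unit disk is represented by the function on \<^typ>\<open>complex\<close> that
  extends it by 0. Equality of functions on the disk is then equality in HOL, and sums, products
  and the zero function are the pointwise ones of \<^theory>\<open>HOL-Library.Function_Algebras\<close>.
\<close>

definition holomorphic_on_disk :: "(complex \<Rightarrow> complex) set" where
  "holomorphic_on_disk = {f. f holomorphic_on ball 0 1 \<and> (\<forall>z. z \<notin> ball 0 1 \<longrightarrow> f z = 0)}"

definition cscale :: "complex \<Rightarrow> (complex \<Rightarrow> complex) \<Rightarrow> (complex \<Rightarrow> complex)" where
  "cscale c f = (\<lambda>z. c * f z)"

interpretation cfun: vector_space cscale
  by unfold_locales (auto simp: cscale_def fun_eq_iff algebra_simps)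

definition taylor_coeff :: "(complex \<Rightarrow> complex) \<Rightarrow> nat \<Rightarrow> complex" where
  "taylor_coeff f n = fps_nth (fps_expansion f 0) n"

definition hardy2 :: "(complex \<Rightarrow> complex) set" where
  "hardy2 = {f \<in> holomorphic_on_disk. summable (\<lambda>n. (cmod (taylor_coeff f n))\<^sup>2)}"

definition hardy2_norm :: "(complex \<Rightarrow> complex) \<Rightarrow> real" where
  "hardy2_norm f = sqrt (\<Sum>n. (cmod (taylor_coeff f n))\<^sup>2)"

definition hardy_inf :: "(complex \<Rightarrow> complex) set" where
  "hardy_inf = {f \<in> holomorphic_on_disk. bounded (f ` ball 0 1)}"

definition mult_z :: "(complex \<Rightarrow> complex) \<Rightarrow> (complex \<Rightarrow> complex)" where
  "mult_z f = (\<lambda>z. z * f z)"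

text \<open>
  In the following, \<open>ip\<close> is an inner product on a space \<open>M\<close> of functions; its values outside
  \<open>M\<close> are irrelevant.
\<close>

type_synonym inner_prod = "(complex \<Rightarrow> complex) \<Rightarrow> (complex \<Rightarrow> complex) \<Rightarrow> complex"

definition inner_product_on :: "(complex \<Rightarrow> complex) set \<Rightarrow> inner_prod \<Rightarrow> bool" where
  "inner_product_on M ip \<longleftrightarrow>
     (\<forall>f\<in>M. \<forall>g\<in>M. \<forall>h\<in>M. ip (f + g) h = ip f h + ip g h) \<and>
     (\<forall>c. \<forall>f\<in>M. \<forall>g\<in>M. ip (cscale c f) g = c * ip f g) \<and>
     (\<forall>f\<in>M. \<forall>g\<in>M. ip g f = cnj (ip f g)) \<and>
     (\<forall>f\<in>M. f \<noteq> 0 \<longrightarrow> Re (ip f f) > 0)"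

definition ip_norm :: "inner_prod \<Rightarrow> (complex \<Rightarrow> complex) \<Rightarrow> real" where
  "ip_norm ip f = sqrt (Re (ip f f))"

definition complete_on :: "(complex \<Rightarrow> complex) set \<Rightarrow> inner_prod \<Rightarrow> bool" where
  "complete_on M ip \<longleftrightarrow>
     (\<forall>s :: nat \<Rightarrow> complex \<Rightarrow> complex. (\<forall>n. s n \<in> M) \<and>
        (\<forall>\<epsilon>>0. \<exists>N. \<forall>m\<ge>N. \<forall>n\<ge>N. ip_norm ip (s m - s n) < \<epsilon>) \<longrightarrow>
        (\<exists>f\<in>M. (\<lambda>n. ip_norm ip (s n - f)) \<longlonglongrightarrow> 0))"

definition hilbert_space_on :: "(complex \<Rightarrow> complex) set \<Rightarrow> inner_prod \<Rightarrow> bool" where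
  "hilbert_space_on M ip \<longleftrightarrow> cfun.subspace M \<and> inner_product_on M ip \<and> complete_on M ip"

definition closure_on ::
  "(complex \<Rightarrow> complex) set \<Rightarrow> inner_prod \<Rightarrow> (complex \<Rightarrow> complex) set \<Rightarrow> (complex \<Rightarrow> complex) set" where
  "closure_on M ip S = {f \<in> M. \<forall>\<epsilon>>0. \<exists>g\<in>S \<inter> M. ip_norm ip (f - g) < \<epsilon>}"

definition bounded_operator_on ::
  "(complex \<Rightarrow> complex) set \<Rightarrow> inner_prod \<Rightarrow> ((complex \<Rightarrow> complex) \<Rightarrow> (complex \<Rightarrow> complex)) \<Rightarrow> bool" where
  "bounded_operator_on M ip T \<longleftrightarrow>
     T ` M \<subseteq> M \<and>
     (\<forall>f\<in>M. \<forall>g\<in>M. T (f + g) = T f + T g) \<and>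
     (\<forall>c. \<forall>f\<in>M. T (cscale c f) = cscale c (T f)) \<and>
     (\<exists>C. \<forall>f\<in>M. ip_norm ip (T f) \<le> C * ip_norm ip f)"

text \<open>
  For a bounded operator \<open>T\<close> on a Hilbert space and \<open>g \<in> M\<close>, the description below denotes
  the unique such \<open>h\<close>, which exists by the Riesz representation theorem.
\<close>

definition adjoint_on ::
  "(complex \<Rightarrow> complex) set \<Rightarrow> inner_prod \<Rightarrow> ((complex \<Rightarrow> complex) \<Rightarrow> (complex \<Rightarrow> complex))
     \<Rightarrow> ((complex \<Rightarrow> complex) \<Rightarrow> (complex \<Rightarrow> complex))" where
  "adjoint_on M ip T g = (THE h. h \<in> M \<and> (\<forall>f\<in>M. ip (T f) g = ip f h))"

definition orthonormal_basis_on ::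
  "(complex \<Rightarrow> complex) set \<Rightarrow> inner_prod \<Rightarrow> (nat \<Rightarrow> complex \<Rightarrow> complex) \<Rightarrow> bool" where
  "orthonormal_basis_on M ip e \<longleftrightarrow>
     (\<forall>n. e n \<in> M) \<and>
     (\<forall>m n. ip (e m) (e n) = (if m = n then 1 else 0)) \<and>
     closure_on M ip (cfun.span (range e)) = M"

definition weighted_shift_on ::
  "(complex \<Rightarrow> complex) set \<Rightarrow> inner_prod \<Rightarrow> ((complex \<Rightarrow> complex) \<Rightarrow> (complex \<Rightarrow> complex)) \<Rightarrow> bool" where
  "weighted_shift_on M ip T \<longleftrightarrow>
     bounded_operator_on M ip T \<and>
     (\<exists>(e :: nat \<Rightarrow> complex \<Rightarrow> complex) (w :: nat \<Rightarrow> real).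
        orthonormal_basis_on M ip e \<and> bounded (range w) \<and> (\<forall>n. w n > 0) \<and>
        (\<forall>n. T (e n) = cscale (complex_of_real (w n)) (e (Suc n))))"

end

theory Submission
  imports Defs
begin

text \<open>
  Let \<open>T\<close> be multiplication by \<open>z\<close>. Condition (ii) says exactly that \<open>T\<^sup>n e\<close> is orthogonal to
  \<open>T\<^sup>n\<^sup>+\<^sup>1 M\<close> for every \<open>e\<close> in the wandering subspace \<open>W\<close>, the orthogonal complement of \<open>T M\<close>.
  As \<open>T\<close> is bounded below and contractive, the series \<open>\<Sum> a\<^sub>n T\<^sup>n e\<close> converges in \<open>M\<close> for square
  summable \<open>a\<close>. Its remainders lie in the closed subspaces \<open>T\<^sup>n M\<close>, whose elements vanish to
  order \<open>n\<close> at 0, so the sum is the function \<open>e f\<close> with \<open>f(z) = \<Sum> a\<^sub>n z\<^sup>n\<close>, although the inclusion of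
  \<open>M\<close> in \<open>H\<^sup>2\<close> need not be continuous. Expanding \<open>e e'\<close> in two ways shows that \<open>W\<close> is a line, and
  since the intersection of the \<open>T\<^sup>n M\<close> is zero, the vectors \<open>T\<^sup>n e\<close> span a dense subspace.
  A unit vector \<open>e\<close> of \<open>W\<close> multiplies \<open>H\<^sup>2\<close> into itself, hence is bounded.
\<close>

subsection \<open>Taylor coefficients and the Hardy space\<close>

lemma funpow_mult_z: "(mult_z ^^ n) f = (\<lambda>z. z ^ n * f z)"
  by (induction n) (auto simp: mult_z_def)

lemma holomorphic_on_disk_closed:
  assumes "f \<in> holomorphic_on_disk" "g \<in> holomorphic_on_disk"
  shows "f + g \<in> holomorphic_on_disk" "f - g \<in> holomorphic_on_disk" "f * g \<in> holomorphic_on_disk"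
    "cscale c f \<in> holomorphic_on_disk" "mult_z f \<in> holomorphic_on_disk"
  using assms
  by (auto simp: holomorphic_on_disk_def plus_fun_def fun_diff_def times_fun_def cscale_def
      mult_z_def intro!: holomorphic_intros)

lemma zero_holomorphic_on_disk: "0 \<in> holomorphic_on_disk"
  by (simp add: holomorphic_on_disk_def zero_fun_def)

lemma has_fps_expansion_taylor:
  assumes "f \<in> holomorphic_on_disk"
  shows "f has_fps_expansion Abs_fps (taylor_coeff f)"
proof -
  have "f has_fps_expansion fps_expansion f 0"
    by (rule has_fps_expansion_fps_expansion[of "ball 0 1"])
      (use assms in \<open>auto simp: holomorphic_on_disk_def\<close>)
  moreover have "fps_expansion f 0 = Abs_fps (taylor_coeff f)"
    by (simp add: fps_eq_iff taylor_coeff_def)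
  ultimately show ?thesis by simp
qed

lemma taylor_coeff_eqI:
  assumes "f has_fps_expansion F" 
  shows "taylor_coeff f n = fps_nth F n"
  by (simp add: fps_expansion_eqI[OF assms] taylor_coeff_def)

lemma taylor_coeff_0 [simp]: "taylor_coeff 0 n = 0"
  using taylor_coeff_eqI[OF has_fps_expansion_0] by (simp add: zero_fun_def)

lemma taylor_coeff_add:
  assumes "f \<in> holomorphic_on_disk" "g \<in> holomorphic_on_disk"
  shows "taylor_coeff (f + g) n = taylor_coeff f n + taylor_coeff g n"
  using taylor_coeff_eqI[OF has_fps_expansion_add[OF assms[THEN has_fps_expansion_taylor]]]
  by (simp add: plus_fun_def)

lemma taylor_coeff_diff:
  assumes "f \<in> holomorphic_on_disk" "g \<in> holomorphic_on_disk"
  shows "taylor_coeff (f - g) n = taylor_coeff f n - taylor_coeff g n"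
  using taylor_coeff_eqI[OF has_fps_expansion_diff[OF assms[THEN has_fps_expansion_taylor]]]
  by (simp add: fun_diff_def)

lemma taylor_coeff_mult:
  assumes "f \<in> holomorphic_on_disk" "g \<in> holomorphic_on_disk"
  shows "taylor_coeff (f * g) n = (\<Sum>i=0..n. taylor_coeff f i * taylor_coeff g (n - i))"
  using taylor_coeff_eqI[OF has_fps_expansion_mult[OF assms[THEN has_fps_expansion_taylor]]]
  by (simp add: times_fun_def fps_mult_nth)

lemma taylor_coeff_cscale:
  assumes "f \<in> holomorphic_on_disk"
  shows "taylor_coeff (cscale c f) n = c * taylor_coeff f n"
  using taylor_coeff_eqI[OF has_fps_expansion_cmult_left[OF assms[THEN has_fps_expansion_taylor]]]
  by (simp add: cscale_def)

lemma taylor_coeff_mult_z: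
  assumes "f \<in> holomorphic_on_disk"
  shows "taylor_coeff (mult_z f) n = (if n = 0 then 0 else taylor_coeff f (n - 1))"
  using taylor_coeff_eqI[OF has_fps_expansion_mult[OF has_fps_expansion_fps_X assms[THEN has_fps_expansion_taylor]]]
  by (simp add: mult_z_def)

lemma funpow_mult_z_holomorphic:
  assumes "f \<in> holomorphic_on_disk"
  shows "(mult_z ^^ n) f \<in> holomorphic_on_disk"
  by (induction n) (use assms in \<open>auto intro: holomorphic_on_disk_closed\<close>)

lemma taylor_coeff_funpow_mult_z:
  assumes "f \<in> holomorphic_on_disk"
  shows "taylor_coeff ((mult_z ^^ m) f) n = (if n < m then 0 else taylor_coeff f (n - m))"
proof (induction m arbitrary: n)
  case (Suc m)
  then show ?case
    by (cases n) (auto simp: taylor_coeff_mult_z funpow_mult_z_holomorphic assms)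
qed simp

lemma taylor_sums:
  assumes "f \<in> holomorphic_on_disk" "cmod z < 1"
  shows "(\<lambda>n. taylor_coeff f n * z ^ n) sums f z"
  using holomorphic_power_series[of f 0 1 z] assms 
    fps_nth_fps_expansion[OF has_fps_expansion_taylor[OF assms(1)]]
  by (simp add: holomorphic_on_disk_def)

lemma holomorphic_on_disk_eqI:
  assumes "f \<in> holomorphic_on_disk" "g \<in> holomorphic_on_disk"
    and "\<And>n. taylor_coeff f n = taylor_coeff g n"
  shows "f = g"
proof
  fix z
  show "f z = g z"
  proof (cases "cmod z < 1")
    case True
    then show ?thesis
      using taylor_sums[OF assms(1) True] taylor_sums[OF assms(2) True] assms(3)
      by (simp add: sums_unique2)
  qed (use assms in \<open>auto simp: holomorphic_on_disk_def\<close>)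
qed

text \<open>Bounded coefficients are dominated by a geometric series at each point of the disk, so
  the power series converges there.\<close>

lemma holomorphic_on_disk_of_coeffs:
  assumes "\<And>n. cmod (a n) \<le> C"
  obtains f where "f \<in> holomorphic_on_disk" "\<And>n. taylor_coeff f n = a n"
proof -
  define f where "f = (\<lambda>z. if z \<in> ball 0 1 then (\<Sum>n. a n * z ^ n) else 0)"
  have sums: "(\<lambda>n. a n * z ^ n) sums f z" if "z \<in> ball 0 1" for z
  proof -
    have "summable (\<lambda>n. a n * z ^ n)"
    proof (rule summable_comparison_test)
      show "\<exists>N. \<forall>n\<ge>N. norm (a n * z ^ n) \<le> C * cmod z ^ n"
        using assms by (auto simp: norm_mult norm_power intro!: mult_right_mono)
      show "summable (\<lambda>n. C * cmod z ^ n)"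
        using that by (intro summable_mult summable_geometric) auto
    qed
    then show ?thesis using that by (simp add: f_def summable_sums)
  qed
  have holo: "f holomorphic_on ball 0 1"
    by (rule power_series_holomorphic[where a = a]) (use sums in simp)
  have "f has_fps_expansion Abs_fps a"
  proof (rule has_fps_expansionI)
    have "eventually (\<lambda>z::complex. z \<in> ball 0 1) (nhds 0)"
      by (rule eventually_nhds_in_open) auto
    then show "eventually (\<lambda>u. (\<lambda>n. fps_nth (Abs_fps a) n * u ^ n) sums f u) (nhds 0)"
      by eventually_elim (use sums in simp)
  qed
  then have "taylor_coeff f n = a n" for n by (simp add: taylor_coeff_eqI)
  moreover have "f \<in> holomorphic_on_disk" using holo by (simp add: holomorphic_on_disk_def f_def)
  ultimately show ?thesis by (rule that[rotated])
qed

section \<open>Norm and linear structure of the Hardy space\<close>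

lemma L2_set_taylor_le_hardy2_norm:
  assumes "f \<in> hardy2"
  shows "L2_set (\<lambda>i. cmod (taylor_coeff f i)) {..<J} \<le> hardy2_norm f"
  using assms by (auto simp: L2_set_def hardy2_norm_def hardy2_def intro!: sum_le_suminf)

text \<open>The sum of the series is the supremum of its finite sections. Inequalities for finite
  sums, such as the triangle inequality of \<open>L2_set\<close>, thus carry over to the Hardy
  norm.\<close>

lemma hardy2I:
  assumes "f \<in> holomorphic_on_disk" "\<And>J. L2_set (\<lambda>i. cmod (taylor_coeff f i)) {..<J} \<le> c"
  shows "f \<in> hardy2" "hardy2_norm f \<le> c"
proof -
  have c: "c \<ge> 0" using assms(2)[of 0] by simp
  have le: "(\<Sum>i<J. (cmod (taylor_coeff f i))\<^sup>2) \<le> c\<^sup>2" for J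
    using assms(2)[of J] by (simp add: L2_set_def sqrt_le_D)
  then have s: "summable (\<lambda>i. (cmod (taylor_coeff f i))\<^sup>2)"
    by (intro summableI_nonneg_bounded[of _ "c\<^sup>2"]) auto
  then show "f \<in> hardy2" using assms(1) by (simp add: hardy2_def)
  show "hardy2_norm f \<le> c"
    unfolding hardy2_norm_def using suminf_le_const[OF s] le c by (intro real_le_lsqrt) auto
qed

lemma hardy2_holomorphic: "f \<in> hardy2 \<Longrightarrow> f \<in> holomorphic_on_disk"
  by (simp add: hardy2_def)

lemma hardy2_add:
  assumes "f \<in> hardy2" "g \<in> hardy2"
  shows "f + g \<in> hardy2" "hardy2_norm (f + g) \<le> hardy2_norm f + hardy2_norm g"
proof -
  note D = assms[THEN hardy2_holomorphic]
  have "L2_set (\<lambda>i. cmod (taylor_coeff (f + g) i)) {..<J} \<le> hardy2_norm f + hardy2_norm g" for J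
  proof -
    have "L2_set (\<lambda>i. cmod (taylor_coeff (f + g) i)) {..<J} \<le>
        L2_set (\<lambda>i. cmod (taylor_coeff f i) + cmod (taylor_coeff g i)) {..<J}"
      by (intro L2_set_mono) (auto simp: taylor_coeff_add D norm_triangle_ineq)
    also have "\<dots> \<le> L2_set (\<lambda>i. cmod (taylor_coeff f i)) {..<J} + L2_set (\<lambda>i. cmod (taylor_coeff g i)) {..<J}"
      by (rule L2_set_triangle_ineq)
    also have "\<dots> \<le> hardy2_norm f + hardy2_norm g"
      by (intro add_mono L2_set_taylor_le_hardy2_norm assms)
    finally show ?thesis .
  qed
  then show "f + g \<in> hardy2" "hardy2_norm (f + g) \<le> hardy2_norm f + hardy2_norm g"
    using hardy2I[OF holomorphic_on_disk_closed(1)[OF D]] by blast+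
qed

lemma hardy2_cscale:
  assumes "f \<in> hardy2"
  shows "cscale c f \<in> hardy2" "hardy2_norm (cscale c f) \<le> cmod c * hardy2_norm f"
proof -
  note D = assms[THEN hardy2_holomorphic]
  have "L2_set (\<lambda>i. cmod (taylor_coeff (cscale c f) i)) {..<J} \<le> cmod c * hardy2_norm f" for J
    using mult_left_mono[OF L2_set_taylor_le_hardy2_norm[OF assms], of "cmod c" J]
    by (simp add: taylor_coeff_cscale D norm_mult L2_set_right_distrib)
  then show "cscale c f \<in> hardy2" "hardy2_norm (cscale c f) \<le> cmod c * hardy2_norm f"
    using hardy2I[OF holomorphic_on_disk_closed(4)[OF D D]] by blast+
qed

lemma subspace_hardy2: "cfun.subspace hardy2"
  by (auto simp: cfun.subspace_def hardy2_add hardy2_cscale intro: hardy2I(1)[where c = 0]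
      zero_holomorphic_on_disk simp: L2_set_0')

lemmas hardy2_diff = cfun.subspace_diff[OF subspace_hardy2]

section \<open>Point evaluations, completeness and multipliers\<close>

lemma hardy2_eval_bound:
  assumes "f \<in> hardy2" "cmod w < 1"
  shows "cmod (f w) * sqrt (1 - (cmod w)\<^sup>2) \<le> hardy2_norm f"
proof -
  have w: "(cmod w)\<^sup>2 < 1" using assms(2) by (simp add: power_less_one_iff)
  have wJ: "L2_set (\<lambda>i. cmod w ^ i) {..<J} * sqrt (1 - (cmod w)\<^sup>2) \<le> 1" for J
  proof -
    have "(\<Sum>i<J. (cmod w ^ i)\<^sup>2) = (\<Sum>i<J. ((cmod w)\<^sup>2) ^ i)"
      by (simp add: power_mult[symmetric] mult.commute)
    then have "(\<Sum>i<J. (cmod w ^ i)\<^sup>2) * (1 - (cmod w)\<^sup>2) = 1 - ((cmod w)\<^sup>2) ^ J"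
      using w by (simp add: sum_gp_strict)
    also have "\<dots> \<le> 1" by simp
    finally show ?thesis by (simp add: L2_set_def flip: real_sqrt_mult)
  qed
  have "cmod (\<Sum>i<J. taylor_coeff f i * w ^ i) * sqrt (1 - (cmod w)\<^sup>2) \<le> hardy2_norm f" for J
  proof -
    \<comment> \<open>Cauchy-Schwarz against the powers of \<open>w\<close>, whose finite sections
      have norm at most (1 - |w|^2)^(-1/2) by \<open>wJ\<close>.\<close>
    have "cmod (\<Sum>i<J. taylor_coeff f i * w ^ i) \<le> (\<Sum>i<J. \<bar>cmod (taylor_coeff f i)\<bar> * \<bar>cmod w ^ i\<bar>)"
      by (rule sum_norm_le) (simp add: norm_mult norm_power)
    also have "\<dots> \<le> L2_set (\<lambda>i. cmod (taylor_coeff f i)) {..<J} * L2_set (\<lambda>i. cmod w ^ i) {..<J}"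
      by (rule L2_set_mult_ineq)
    finally have "cmod (\<Sum>i<J. taylor_coeff f i * w ^ i) * sqrt (1 - (cmod w)\<^sup>2) \<le>
        L2_set (\<lambda>i. cmod (taylor_coeff f i)) {..<J} * (L2_set (\<lambda>i. cmod w ^ i) {..<J} * sqrt (1 - (cmod w)\<^sup>2))"
      using w by (simp add: mult_right_mono)
    also have "\<dots> \<le> L2_set (\<lambda>i. cmod (taylor_coeff f i)) {..<J} * 1"
      by (intro mult_left_mono wJ) simp
    finally show ?thesis using L2_set_taylor_le_hardy2_norm[OF assms(1), of J] by simp
  qed
  moreover have "(\<lambda>J. cmod (\<Sum>i<J. taylor_coeff f i * w ^ i) * sqrt (1 - (cmod w)\<^sup>2))
      \<longlonglongrightarrow> cmod (f w) * sqrt (1 - (cmod w)\<^sup>2)"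
    using taylor_sums[OF hardy2_holomorphic[OF assms(1)] assms(2)]
    by (intro tendsto_intros) (simp add: sums_def)
  ultimately show ?thesis by (intro LIMSEQ_le_const2) auto
qed

text \<open>The witness is the reproducing kernel at \<open>w\<close> divided by its norm; it
  attains equality in \<open>hardy2_eval_bound\<close>.\<close>

lemma normalised_kernel:
  assumes "cmod w < 1"
  obtains k where "k \<in> hardy2" "hardy2_norm k \<le> 1" "cmod (k w) * sqrt (1 - (cmod w)\<^sup>2) = 1"
proof -
  have w: "(cmod w)\<^sup>2 < 1" using assms by (simp add: power_less_one_iff)
  define s where "s = sqrt (1 - (cmod w)\<^sup>2)"
  have s: "0 < s" "s\<^sup>2 = 1 - (cmod w)\<^sup>2" "s \<le> 1" using w by (auto simp: s_def)
  define a where "a = (\<lambda>n. of_real s * cnj w ^ n)"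
  have "cmod (a n) \<le> 1" for n
    using s assms by (auto simp: a_def norm_mult norm_power intro!: mult_le_one power_le_one)
  then obtain k where k: "k \<in> holomorphic_on_disk" "\<And>n. taylor_coeff k n = a n"
    using holomorphic_on_disk_of_coeffs by blast
  have "L2_set (\<lambda>i. cmod (taylor_coeff k i)) {..<J} \<le> 1" for J
  proof -
    have "(\<Sum>i<J. (cmod (a i))\<^sup>2) = s\<^sup>2 * (\<Sum>i<J. ((cmod w)\<^sup>2) ^ i)"
      using s by (simp add: a_def norm_mult norm_power power_mult_distrib sum_distrib_left
          power_mult[symmetric] mult.commute)
    also have "\<dots> = 1 - ((cmod w)\<^sup>2) ^ J"
      using w by (simp add: s sum_gp_strict)
    also have "\<dots> \<le> 1" by simp
    finally show ?thesis by (simp add: L2_set_def k)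
  qed
  then have "k \<in> hardy2" "hardy2_norm k \<le> 1" using hardy2I[OF k(1)] by auto
  moreover have "cmod (k w) * s = 1"
  proof -
    have "(\<lambda>n. of_real s * (of_real ((cmod w)\<^sup>2)) ^ n) sums (of_real s * (1 / (1 - of_real ((cmod w)\<^sup>2)) :: complex))"
      using w by (intro sums_mult geometric_sums) (simp add: norm_power)
    moreover have "(\<lambda>n. of_real s * (of_real ((cmod w)\<^sup>2)) ^ n) = (\<lambda>n. taylor_coeff k n * w ^ n)"
      unfolding k a_def complex_norm_square by (simp add: fun_eq_iff power_mult_distrib mult_ac)
    ultimately have "(\<lambda>n. taylor_coeff k n * w ^ n) sums (of_real s * (1 / (1 - of_real ((cmod w)\<^sup>2)) :: complex))" by simp
    then have "k w = of_real s * (1 / (1 - of_real ((cmod w)\<^sup>2)))"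
      using taylor_sums[OF k(1) assms] sums_unique2 by blast
    also have "\<dots> = of_real (s * (1 / s\<^sup>2))" by (simp add: s)
    finally have "cmod (k w) = \<bar>s * (1 / s\<^sup>2)\<bar>" by (simp only: norm_of_real)
    then show ?thesis using s(1) by (simp add: power2_eq_square)
  qed
  ultimately show ?thesis using that by (simp add: s_def)
qed

text \<open>Completeness of the Hardy space with an explicit rate. Each coefficient converges
  separately, and the estimates for finite sections pass to the limit because they involve only
  finitely many coefficients.\<close>

lemma hardy2_limit:
  assumes F: "\<And>n. F n \<in> hardy2"
    and le: "\<And>m n. n \<le> m \<Longrightarrow> hardy2_norm (F m - F n) \<le> \<epsilon> n"
    and lim: "\<epsilon> \<longlonglongrightarrow> 0"
  obtains f where "f \<in> hardy2" "\<And>n. hardy2_norm (f - F n) \<le> \<epsilon> n"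
proof -
  note D = F[THEN hardy2_holomorphic]
  let ?c = "\<lambda>n. taylor_coeff (F n)"
  have c_le: "L2_set (\<lambda>i. cmod (?c m i - ?c n i)) {..<J} \<le> \<epsilon> n" if "n \<le> m" for m n J
    using order_trans[OF L2_set_taylor_le_hardy2_norm[OF hardy2_diff[OF F F]] le[OF that]]
    by (simp add: taylor_coeff_diff D)
  have member: "x j \<le> L2_set x {..<Suc j}" for x j by (rule member_le_L2_set) auto
  have c1: "cmod (?c m j - ?c n j) \<le> \<epsilon> n" if "n \<le> m" for m n j
    using member[of "\<lambda>j. cmod (?c m j - ?c n j)" j] c_le[OF that, of "Suc j"] by linarith
  have "Cauchy (\<lambda>n. ?c n j)" for j
  proof (rule metric_CauchyI)
    fix e :: real assume "0 < e"
    then have "eventually (\<lambda>n. \<epsilon> n < e / 2) sequentially"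
      by (intro order_tendstoD(2)[OF lim]) simp
    then obtain N where N: "\<epsilon> N < e / 2" by (auto simp: eventually_sequentially)
    have "dist (?c m j) (?c n j) < e" if "m \<ge> N" "n \<ge> N" for m n
      using c1[OF that(1), of j] c1[OF that(2), of j] N dist_triangle2[of "?c m j" "?c n j" "?c N j"]
      by (simp add: dist_norm)
    then show "\<exists>M. \<forall>m\<ge>M. \<forall>n\<ge>M. dist (?c m j) (?c n j) < e" by blast
  qed
  then have "\<exists>a. \<forall>j. (\<lambda>n. ?c n j) \<longlonglongrightarrow> a j"
    by (intro choice allI) (simp add: Cauchy_convergent_iff convergent_def)
  then obtain a where a: "\<And>j. (\<lambda>n. ?c n j) \<longlonglongrightarrow> a j" by blast
  have a_le: "L2_set (\<lambda>i. cmod (a i - ?c n i)) {..<J} \<le> \<epsilon> n" for n J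
  proof (rule LIMSEQ_le_const2)
    show "(\<lambda>m. L2_set (\<lambda>i. cmod (?c m i - ?c n i)) {..<J}) \<longlonglongrightarrow> L2_set (\<lambda>i. cmod (a i - ?c n i)) {..<J}"
      unfolding L2_set_def by (intro tendsto_intros a)
    show "\<exists>N. \<forall>m\<ge>N. L2_set (\<lambda>i. cmod (?c m i - ?c n i)) {..<J} \<le> \<epsilon> n"
      using c_le by blast
  qed
  \<comment> \<open>A bound independent of \<open>j\<close>, so that the limits are the coefficients
    of a function on the disk.\<close>
  have "cmod (a j) \<le> hardy2_norm (F 0) + \<epsilon> 0" for j
  proof -
    have "cmod (?c 0 j) \<le> hardy2_norm (F 0)"
      using member[of "\<lambda>j. cmod (?c 0 j)" j] L2_set_taylor_le_hardy2_norm[OF F[of 0], of "Suc j"]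
      by linarith
    moreover have "cmod (a j - ?c 0 j) \<le> \<epsilon> 0"
      using member[of "\<lambda>j. cmod (a j - ?c 0 j)" j] a_le[of 0 "Suc j"] by linarith
    ultimately show ?thesis using norm_triangle_sub[of "a j" "?c 0 j"] by simp
  qed
  then obtain f where f: "f \<in> holomorphic_on_disk" "\<And>n. taylor_coeff f n = a n"
    using holomorphic_on_disk_of_coeffs by blast
  have "L2_set (\<lambda>i. cmod (taylor_coeff (f - F n) i)) {..<J} \<le> \<epsilon> n" for n J
    by (simp add: taylor_coeff_diff f D a_le)
  then have d: "f - F n \<in> hardy2" "hardy2_norm (f - F n) \<le> \<epsilon> n" for n
    using hardy2I[OF holomorphic_on_disk_closed(2)[OF f(1) D]] by blast+
  have "f - F 0 + F 0 \<in> hardy2" by (intro hardy2_add d F)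
  then have "f \<in> hardy2" by simp
  then show ?thesis using d(2) by (rule that)
qed

text \<open>
  The functionals \<open>f \<mapsto> b(w) f(w) \<parallel>k\<^sub>w\<parallel>\<^sup>-\<^sup>1\<close>, with \<open>k\<^sub>w\<close> the reproducing kernel, are pointwise bounded on
  \<open>H\<^sup>2\<close> and have norm \<open>|b(w)|\<close>. The uniform boundedness principle is proved by Sokal's argument:
  one of \<open>F n \<plusminus> y n\<close> makes the \<open>n\<close>-th functional large, and the later steps are too small to
  undo this.
\<close>

lemma hardy2_multiplier_bounded:
  assumes b: "b \<in> holomorphic_on_disk" and mult: "\<And>f. f \<in> hardy2 \<Longrightarrow> b * f \<in> hardy2"
  shows "b \<in> hardy_inf"
proof (rule ccontr)
  assume "b \<notin> hardy_inf"
  then have unb: "\<not> bounded (b ` ball 0 1)" using b by (simp add: hardy_inf_def)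
  \<comment> \<open>The growth rate 4^n is chosen to beat the step sizes (1/3)^n of \<open>y\<close>
    below: the contradiction will come from (4/3)^n being unbounded.\<close>
  have "\<exists>w k. cmod w < 1 \<and> cmod (b w) \<ge> 4 ^ n \<and> k \<in> hardy2 \<and> hardy2_norm k \<le> 1 \<and>
      cmod (k w) * sqrt (1 - (cmod w)\<^sup>2) = 1" for n
  proof -
    obtain w where "cmod w < 1" "cmod (b w) \<ge> 4 ^ n"
      using unb unfolding bounded_iff by (auto simp: not_le dest!: spec[of _ "4 ^ n"] less_imp_le)
    with normalised_kernel[of w] show ?thesis by metis
  qed
  then obtain w k where wk: "\<And>n. cmod (w n) < 1" "\<And>n. cmod (b (w n)) \<ge> 4 ^ n"
      "\<And>n. k n \<in> hardy2" "\<And>n. hardy2_norm (k n) \<le> 1"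
      "\<And>n. cmod (k n (w n)) * sqrt (1 - (cmod (w n))\<^sup>2) = 1"
    by metis
  define s where "s = (\<lambda>n. sqrt (1 - (cmod (w n))\<^sup>2))"
  have s: "s n \<ge> 0" for n using wk(1)[of n] by (auto simp: s_def power_le_one)
  define y where "y = (\<lambda>n::nat. cscale ((1/3) ^ n) (k n))"
  have y: "y n \<in> hardy2" "hardy2_norm (y n) \<le> (1/3) ^ n" for n
    unfolding y_def using hardy2_cscale[OF wk(3)[of n], of "(1/3) ^ n"]
      mult_left_le[OF wk(4)[of n], of "(1/3) ^ n"]
    by (auto simp: norm_power intro: order_trans)
  have yw: "cmod (y n (w n)) * s n = (1/3) ^ n" for n
    using wk(5)[of n] by (simp add: y_def s_def cscale_def norm_mult norm_divide norm_power field_simps)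
  define F where "F = rec_nat (0 :: complex \<Rightarrow> complex) (\<lambda>n g.
      if cmod ((g + y n) (w n)) * s n \<ge> (1/3) ^ n then g + y n else g - y n)"
  have F0: "F 0 = 0" and FS: "F (Suc n) =
      (if cmod ((F n + y n) (w n)) * s n \<ge> (1/3) ^ n then F n + y n else F n - y n)" for n
    by (simp_all add: F_def)
  have F: "F n \<in> hardy2" for n
    by (induction n)
      (use cfun.subspace_0[OF subspace_hardy2] in \<open>auto simp: F0 FS zero_fun_def intro!: hardy2_add hardy2_diff y\<close>)
  have Fw: "cmod (F (Suc n) (w n)) * s n \<ge> (1/3) ^ n" for n
  proof (rule ccontr)
    assume less: "\<not> ?thesis"
    then have "\<not> cmod ((F n + y n) (w n)) * s n \<ge> (1/3) ^ n" by (auto simp: FS)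
    with less have *: "cmod (F n (w n) + y n (w n)) * s n < (1/3) ^ n"
        "cmod (F n (w n) - y n (w n)) * s n < (1/3) ^ n"
      by (simp_all add: FS split: if_splits)
    \<comment> \<open>The two candidates differ by twice \<open>y n\<close>, so they cannot both be
      small at \<open>w n\<close>.\<close>
    have "2 * cmod (y n (w n)) = cmod ((F n (w n) + y n (w n)) - (F n (w n) - y n (w n)))"
      by (simp add: norm_mult flip: mult_2)
    also have "\<dots> \<le> cmod (F n (w n) + y n (w n)) + cmod (F n (w n) - y n (w n))"
      by (rule norm_triangle_ineq4)
    finally have "2 * (cmod (y n (w n)) * s n) \<le>
        cmod (F n (w n) + y n (w n)) * s n + cmod (F n (w n) - y n (w n)) * s n"
      using mult_right_mono[OF _ s[of n]] by (fastforce simp: algebra_simps)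
    then show False using * yw[of n] by simp
  qed
  have Fstep: "hardy2_norm (F (Suc n) - F n) \<le> (1/3) ^ n" for n
  proof -
    have "F n - y n - F n = cscale (-1) (y n)" by (simp add: cscale_def fun_eq_iff)
    then have "hardy2_norm (F n - y n - F n) \<le> (1/3) ^ n"
      using hardy2_cscale(2)[OF y(1), of "-1" n] y(2)[of n] by simp
    then show ?thesis using y(2)[of n] by (simp add: FS)
  qed
  \<comment> \<open>The number 3/2 * (1/3)^n is the geometric tail from index \<open>n\<close> on;
    keeping the subtracted term makes the induction close.\<close>
  have Fdiff: "hardy2_norm (F (n + j) - F n) \<le> 3/2 * (1/3) ^ n - 3/2 * (1/3) ^ (n + j)" for n j
  proof (induction j)
    case 0
    have "hardy2_norm 0 = 0" by (simp add: hardy2_norm_def)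
    then have "hardy2_norm (F (n + 0) - F n) \<le> 3/2 * (1/3) ^ n - 3/2 * (1/3) ^ (n + 0)" by simp
    then show ?case .
  next
    case (Suc j)
    have "F (n + Suc j) - F n = (F (Suc (n + j)) - F (n + j)) + (F (n + j) - F n)" by simp
    then have "hardy2_norm (F (n + Suc j) - F n) \<le>
        hardy2_norm (F (Suc (n + j)) - F (n + j)) + hardy2_norm (F (n + j) - F n)"
      using hardy2_add(2)[OF hardy2_diff[OF F F] hardy2_diff[OF F F]] by metis
    also have "\<dots> \<le> (1/3) ^ (n + j) + (3/2 * (1/3) ^ n - 3/2 * (1/3) ^ (n + j))"
      by (rule add_mono[OF Fstep Suc])
    also have "\<dots> = 3/2 * (1/3) ^ n - 3/2 * (1/3) ^ (n + Suc j)" by simp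
    finally show ?case .
  qed
  obtain f where f: "f \<in> hardy2" "\<And>n. hardy2_norm (f - F n) \<le> 3/2 * (1/3) ^ n"
  proof (rule hardy2_limit[OF F])
    show "hardy2_norm (F m - F n) \<le> 3/2 * (1/3) ^ n" if "n \<le> m" for m n
    proof -
      have "0 \<le> (1/3::real) ^ m" by simp
      with Fdiff[of n "m - n"] that show ?thesis by (simp only: le_add_diff_inverse)
    qed
    show "(\<lambda>n. 3/2 * (1/3::real) ^ n) \<longlonglongrightarrow> 0"
      by (intro tendsto_mult_right_zero LIMSEQ_power_zero) simp
  qed (use that in blast)
  have "(4/3) ^ n \<le> 2 * hardy2_norm (b * f)" for n
  proof -
    \<comment> \<open>All later steps together contribute at most 3/2 * (1/3)^(n+1), which is half
      of what step \<open>n\<close> has secured.\<close>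
    have "cmod ((f - F (Suc n)) (w n)) * s n \<le> 1/2 * (1/3) ^ n"
      using hardy2_eval_bound[OF hardy2_diff[OF f(1) F] wk(1), of "Suc n" n] f(2)[of "Suc n"]
      by (simp add: s_def)
    moreover have "cmod (F (Suc n) (w n)) * s n \<le>
        cmod (f (w n)) * s n + cmod ((f - F (Suc n)) (w n)) * s n"
      using mult_right_mono[OF norm_triangle_ineq4[of "f (w n)" "(f - F (Suc n)) (w n)"] s[of n]]
      by (simp add: distrib_right)
    ultimately have "cmod (f (w n)) * s n \<ge> 1/2 * (1/3) ^ n" using Fw[of n] by linarith
    then have "4 ^ n * (1/2 * (1/3) ^ n) \<le> cmod (b (w n)) * (cmod (f (w n)) * s n)"
      by (rule mult_mono[OF wk(2)]) auto
    also have "\<dots> \<le> hardy2_norm (b * f)"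
      using hardy2_eval_bound[OF mult[OF f(1)] wk(1), of n] by (simp add: s_def norm_mult mult.assoc)
    finally show ?thesis by (simp add: power_divide)
  qed
  moreover obtain n where "2 * hardy2_norm (b * f) < (4/3) ^ n"
    using real_arch_pow[of "4/3"] by auto
  ultimately show False by (meson not_le)
qed

subsection \<open>Hilbert spaces of functions\<close>

text \<open>The carrier is a set, so that the results can be applied to closed subspaces by
  interpretation with the same \<open>ip\<close>.\<close>

locale function_hilbert_space =
  fixes M :: "(complex \<Rightarrow> complex) set" and ip :: inner_prod
  assumes hilbert: "hilbert_space_on M ip"
begin

lemma subspace: "cfun.subspace M" and inner: "inner_product_on M ip" and complete: "complete_on M ip"
  using hilbert by (auto simp: hilbert_space_on_def)

lemma closed [simp]:
  shows "0 \<in> M"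
    and "f \<in> M \<Longrightarrow> g \<in> M \<Longrightarrow> f + g \<in> M"
    and "f \<in> M \<Longrightarrow> g \<in> M \<Longrightarrow> f - g \<in> M"
    and "f \<in> M \<Longrightarrow> cscale c f \<in> M"
  using subspace by (auto simp: cfun.subspace_0 cfun.subspace_add cfun.subspace_diff cfun.subspace_scale)

lemma sum_closed [simp]: "(\<And>k. k \<in> A \<Longrightarrow> x k \<in> M) \<Longrightarrow> sum x A \<in> M"
  by (rule cfun.subspace_sum[OF subspace])

lemmas ip_add_left [simp] = inner[unfolded inner_product_on_def, THEN conjunct1, rule_format]
  and ip_cscale_left [simp] = inner[unfolded inner_product_on_def, THEN conjunct2, THEN conjunct1, rule_format]
  and ip_cnj = inner[unfolded inner_product_on_def, THEN conjunct2, THEN conjunct2, THEN conjunct1, rule_format]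
  and ip_pos = inner[unfolded inner_product_on_def, THEN conjunct2, THEN conjunct2, THEN conjunct2, rule_format]

lemma ip_zero_left [simp]: "g \<in> M \<Longrightarrow> ip 0 g = 0"
  using ip_cscale_left[of 0 g 0] by simp

lemma ip_diff_left [simp]:
  assumes "f \<in> M" "g \<in> M" "h \<in> M"
  shows "ip (f - g) h = ip f h - ip g h"
  using ip_add_left[of "f - g" g h] assms by simp

lemma ip_add_right [simp]: "f \<in> M \<Longrightarrow> g \<in> M \<Longrightarrow> h \<in> M \<Longrightarrow> ip h (f + g) = ip h f + ip h g"
  and ip_diff_right [simp]: "f \<in> M \<Longrightarrow> g \<in> M \<Longrightarrow> h \<in> M \<Longrightarrow> ip h (f - g) = ip h f - ip h g"
  and ip_cscale_right [simp]: "f \<in> M \<Longrightarrow> h \<in> M \<Longrightarrow> ip h (cscale c f) = cnj c * ip h f"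
  and ip_zero_right [simp]: "h \<in> M \<Longrightarrow> ip h 0 = 0"
  by (simp_all add: ip_cnj[of _ h])

lemma ip_eq_0_sym: "f \<in> M \<Longrightarrow> g \<in> M \<Longrightarrow> ip f g = 0 \<longleftrightarrow> ip g f = 0"
  by (auto simp: ip_cnj[of f g])

lemma ip_sum_left: "(\<And>k. k \<in> A \<Longrightarrow> x k \<in> M) \<Longrightarrow> g \<in> M \<Longrightarrow> ip (sum x A) g = (\<Sum>k\<in>A. ip (x k) g)"
  by (induction A rule: infinite_finite_induct) simp_all

section \<open>Norm, Cauchy-Schwarz inequality and convergence\<close>

lemma Re_ip_nonneg: "f \<in> M \<Longrightarrow> Re (ip f f) \<ge> 0"
  using ip_pos[of f] by (cases "f = 0") auto

lemma norm_nonneg [simp]: "f \<in> M \<Longrightarrow> ip_norm ip f \<ge> 0"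
  by (simp add: ip_norm_def Re_ip_nonneg)

lemma norm_sq: "f \<in> M \<Longrightarrow> (ip_norm ip f)\<^sup>2 = Re (ip f f)"
  by (simp add: ip_norm_def Re_ip_nonneg)

lemma ip_self: "f \<in> M \<Longrightarrow> ip f f = of_real ((ip_norm ip f)\<^sup>2)"
  using arg_cong[OF ip_cnj[of f f], of Im] by (simp add: norm_sq complex_eq_iff)

lemma norm_eq_0_iff [simp]: "f \<in> M \<Longrightarrow> ip_norm ip f = 0 \<longleftrightarrow> f = 0"
  using ip_pos[of f] by (cases "f = 0") (auto simp: ip_norm_def)

lemma norm_zero [simp]: "ip_norm ip 0 = 0"
  by simp

lemma norm_pos: "f \<in> M \<Longrightarrow> f \<noteq> 0 \<Longrightarrow> ip_norm ip f > 0"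
  by (simp add: less_le)

lemma norm_cscale [simp]:
  assumes "f \<in> M"
  shows "ip_norm ip (cscale c f) = cmod c * ip_norm ip f"
proof -
  have "ip (cscale c f) (cscale c f) = of_real ((cmod c * ip_norm ip f)\<^sup>2)"
  proof -
    have "ip (cscale c f) (cscale c f) = c * cnj c * ip f f" using assms by simp
    then show ?thesis
      by (simp only: ip_self[OF assms] complex_norm_square[symmetric] of_real_mult[symmetric] power_mult_distrib)
  qed
  then have "ip_norm ip (cscale c f) = sqrt ((cmod c * ip_norm ip f)\<^sup>2)"
    by (simp only: ip_norm_def[of ip "cscale c f"] Re_complex_of_real)
  then show ?thesis using assms by simp
qed

lemma norm_add_sq:
  assumes "f \<in> M" "g \<in> M"
  shows "(ip_norm ip (f + g))\<^sup>2 = (ip_norm ip f)\<^sup>2 + (ip_norm ip g)\<^sup>2 + 2 * Re (ip f g)"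
  using assms by (simp add: norm_sq ip_cnj[of f g])

lemma norm_diff_sq:
  assumes "f \<in> M" "g \<in> M"
  shows "(ip_norm ip (f - g))\<^sup>2 = (ip_norm ip f)\<^sup>2 + (ip_norm ip g)\<^sup>2 - 2 * Re (ip f g)"
  using assms by (simp add: norm_sq ip_cnj[of f g])

lemma norm_minus_commute: 
  assumes "f \<in> M" "g \<in> M"
  shows "ip_norm ip (f - g) = ip_norm ip (g - f)"
  by (rule power2_eq_imp_eq) (use assms in \<open>auto simp: norm_diff_sq ip_cnj[of f g]\<close>)

lemma cauchy_schwarz:
  assumes f: "f \<in> M" and g: "g \<in> M"
  shows "cmod (ip f g) \<le> ip_norm ip f * ip_norm ip g"
proof (cases "g = 0")
  case False
  define G where "G = (ip_norm ip g)\<^sup>2"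
  have G: "G > 0" using norm_pos[OF g False] by (simp add: G_def)
  \<comment> \<open>Up to the factor \<open>G\<close>, this is the component of \<open>f\<close>
    orthogonal to \<open>g\<close>. Its square norm is \<open>G\<close> times the difference of the
    two squares to be compared.\<close>
  define h where "h = cscale (of_real G) f - cscale (ip f g) g"
  have h: "h \<in> M" using f g by (simp add: h_def)
  have gg: "ip g g = of_real G" using ip_self[OF g] by (simp add: G_def)
  have ff: "ip f f = of_real ((ip_norm ip f)\<^sup>2)" using ip_self[OF f] .
  have gf: "ip g f = cnj (ip f g)" by (rule ip_cnj[OF f g])
  have "ip h h = of_real G * (of_real (G * (ip_norm ip f)\<^sup>2) - ip f g * cnj (ip f g))"
  proof -
    have "ip h h = of_real G * (of_real G * ip f f - cnj (ip f g) * ip f g)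
        - ip f g * (of_real G * ip g f - cnj (ip f g) * ip g g)"
      using f g by (simp add: h_def algebra_simps)
    then show ?thesis unfolding gg ff gf by (simp add: algebra_simps)
  qed
  also have "\<dots> = of_real (G * (G * (ip_norm ip f)\<^sup>2 - (cmod (ip f g))\<^sup>2))"
    by (simp only: complex_norm_square[symmetric] of_real_mult of_real_diff)
  finally have "0 \<le> G * (G * (ip_norm ip f)\<^sup>2 - (cmod (ip f g))\<^sup>2)"
    using Re_ip_nonneg[OF h] by (simp only: Re_complex_of_real)
  then have "0 \<le> G * (ip_norm ip f)\<^sup>2 - (cmod (ip f g))\<^sup>2"
    using G by (simp only: zero_le_mult_iff) auto
  then have "(cmod (ip f g))\<^sup>2 \<le> (ip_norm ip f * ip_norm ip g)\<^sup>2"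
    by (simp add: power_mult_distrib G_def[symmetric] mult.commute)
  then show ?thesis by (rule power2_le_imp_le) (use f g in simp)
qed (use assms in simp)

lemma norm_triangle:
  assumes f: "f \<in> M" and g: "g \<in> M"
  shows "ip_norm ip (f + g) \<le> ip_norm ip f + ip_norm ip g"
proof (rule power2_le_imp_le)
  have "Re (ip f g) \<le> ip_norm ip f * ip_norm ip g"
    using cauchy_schwarz[OF f g] complex_Re_le_cmod order_trans by blast
  then show "(ip_norm ip (f + g))\<^sup>2 \<le> (ip_norm ip f + ip_norm ip g)\<^sup>2"
    using f g by (simp add: norm_add_sq power2_sum)
qed (use assms in simp)

lemma norm_triangle_diff:
  assumes "f \<in> M" "g \<in> M" "h \<in> M"
  shows "ip_norm ip (f - h) \<le> ip_norm ip (f - g) + ip_norm ip (g - h)"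
  using norm_triangle[of "f - g" "g - h"] assms by simp

lemma limit_unique:
  assumes "\<And>n. s n \<in> M" "f \<in> M" "g \<in> M"
    and "(\<lambda>n. ip_norm ip (s n - f)) \<longlonglongrightarrow> 0" "(\<lambda>n. ip_norm ip (s n - g)) \<longlonglongrightarrow> 0"
  shows "f = g"
proof -
  have "(\<lambda>n. ip_norm ip (s n - f) + ip_norm ip (s n - g)) \<longlonglongrightarrow> 0 + 0"
    by (intro tendsto_add assms)
  moreover have "ip_norm ip (f - g) \<le> ip_norm ip (s n - f) + ip_norm ip (s n - g)" for n
    using norm_triangle_diff[of f "s n" g] norm_minus_commute[of "s n" f] assms by simp
  ultimately have "ip_norm ip (f - g) \<le> 0 + 0" by (intro LIMSEQ_le_const) auto
  then have "ip_norm ip (f - g) = 0" by (intro antisym) (use assms in simp_all)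
  then show ?thesis using assms by simp
qed

lemma convergent_imp_Cauchy:
  assumes s: "\<And>n. s n \<in> M" and f: "f \<in> M" and lim: "(\<lambda>n. ip_norm ip (s n - f)) \<longlonglongrightarrow> 0"
    and "\<epsilon> > 0"
  shows "\<exists>N. \<forall>m\<ge>N. \<forall>n\<ge>N. ip_norm ip (s m - s n) < \<epsilon>"
proof -
  have "eventually (\<lambda>n. ip_norm ip (s n - f) < \<epsilon> / 2) sequentially"
    by (rule order_tendstoD(2)[OF lim]) (use \<open>\<epsilon> > 0\<close> in simp)
  then obtain N where N: "\<And>n. n \<ge> N \<Longrightarrow> ip_norm ip (s n - f) < \<epsilon> / 2"
    by (auto simp: eventually_sequentially)
  have "ip_norm ip (s m - s n) < \<epsilon>" if "m \<ge> N" "n \<ge> N" for m n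
    using norm_triangle_diff[OF s[of m] f s[of n]] N[OF that(1)] N[OF that(2)]
      norm_minus_commute[OF s[of n] f] by simp
  then show ?thesis by blast
qed

lemma completeD:
  assumes "\<And>n. s n \<in> M" "\<And>\<epsilon>. \<epsilon> > 0 \<Longrightarrow> \<exists>N. \<forall>m\<ge>N. \<forall>n\<ge>N. ip_norm ip (s m - s n) < \<epsilon>"
  obtains f where "f \<in> M" "(\<lambda>n. ip_norm ip (s n - f)) \<longlonglongrightarrow> 0"
  using complete assms unfolding complete_on_def by metis

lemma pythagoras:
  assumes "finite A" "\<And>k. k \<in> A \<Longrightarrow> x k \<in> M"
    and "\<And>j k. j \<in> A \<Longrightarrow> k \<in> A \<Longrightarrow> j \<noteq> k \<Longrightarrow> ip (x j) (x k) = 0"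
  shows "(ip_norm ip (sum x A))\<^sup>2 = (\<Sum>k\<in>A. (ip_norm ip (x k))\<^sup>2)"
  using assms
proof (induction A rule: finite_induct)
  case (insert a A)
  have "ip (sum x A) (x a) = 0"
    using insert by (subst ip_sum_left) (auto intro!: sum.neutral)
  then have "ip (x a) (sum x A) = 0" using insert.prems ip_eq_0_sym[of "x a" "sum x A"] by simp
  then have "(ip_norm ip (x a + sum x A))\<^sup>2 = (ip_norm ip (x a))\<^sup>2 + (\<Sum>k\<in>A. (ip_norm ip (x k))\<^sup>2)"
    using insert by (subst norm_add_sq) auto
  then show ?case unfolding sum.insert[OF insert.hyps(1,2)] .
qed simp

text \<open>The representing vector minimises \<open>\<parallel>f\<parallel>\<^sup>2 - 2 Re (\<phi> f)\<close>; the parallelogram law makes every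
  minimising sequence a Cauchy sequence.\<close>

theorem riesz:
  assumes add: "\<And>f g. f \<in> M \<Longrightarrow> g \<in> M \<Longrightarrow> \<phi> (f + g) = \<phi> f + \<phi> g"
    and scale: "\<And>c f. f \<in> M \<Longrightarrow> \<phi> (cscale c f) = c * \<phi> f"
    and bound: "\<And>f. f \<in> M \<Longrightarrow> cmod (\<phi> f) \<le> C * ip_norm ip f"
  obtains h where "h \<in> M" "\<And>f. f \<in> M \<Longrightarrow> \<phi> f = ip f h"
proof -
  define J where "J f = (ip_norm ip f)\<^sup>2 - 2 * Re (\<phi> f)" for f
  have J_lower: "- C\<^sup>2 \<le> J f" if f: "f \<in> M" for f
  proof -
    \<comment> \<open>Completing the square in the norm of \<open>f\<close> bounds \<open>J\<close>
      from below.\<close>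
    have "Re (\<phi> f) \<le> C * ip_norm ip f"
      using bound[OF f] complex_Re_le_cmod order_trans by blast
    moreover have "0 \<le> (ip_norm ip f - C)\<^sup>2" by simp
    ultimately show ?thesis by (simp add: J_def power2_diff mult.commute)
  qed
  define m where "m = Inf (J ` M)"
  have bdd: "bdd_below (J ` M)" using J_lower by (intro bdd_belowI) auto
  have m_le: "m \<le> J f" if "f \<in> M" for f
    unfolding m_def using that by (intro cInf_lower bdd) auto
  define r where "r = (\<lambda>n. 1 / real (Suc n))"
  have r: "r n > 0" "n \<le> k \<Longrightarrow> r k \<le> r n" for n k by (auto simp: r_def divide_simps)
  have "\<exists>s\<in>M. J s < m + r n" for n
  proof -
    have "J ` M \<noteq> {}" using closed(1) by blast
    moreover have "Inf (J ` M) < m + r n" using r(1) by (simp add: m_def)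
    ultimately have "\<exists>x\<in>J ` M. x < m + r n" by (rule cInf_lessD)
    then show ?thesis by simp
  qed
  then obtain s where s: "\<And>n. s n \<in> M" "\<And>n. J (s n) < m + r n" by metis
  have mid: "(ip_norm ip (f - g))\<^sup>2 \<le> 2 * (J f - m) + 2 * (J g - m)" if "f \<in> M" "g \<in> M" for f g
  proof -
    \<comment> \<open>The parallelogram law at the midpoint of \<open>f\<close> and
      \<open>g\<close>, where \<open>J\<close> is still at least the infimum
      \<open>m\<close>.\<close>
    have "4 * J (cscale (1/2) (f + g)) = (ip_norm ip (f + g))\<^sup>2 - 4 * Re (\<phi> f) - 4 * Re (\<phi> g)"
    proof -
      have n: "ip_norm ip (cscale (1/2) (f + g)) = ip_norm ip (f + g) / 2"
        by (subst norm_cscale) (use that in auto)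
      have p: "\<phi> (cscale (1/2) (f + g)) = (\<phi> f + \<phi> g) / 2"
        by (subst scale) (use that add in auto)
      show ?thesis unfolding J_def n p by (simp add: power_divide field_simps)
    qed
    then have "(ip_norm ip (f - g))\<^sup>2 = 2 * J f + 2 * J g - 4 * J (cscale (1/2) (f + g))"
      using that by (simp add: J_def norm_add_sq norm_diff_sq)
    then show ?thesis using m_le[of "cscale (1/2) (f + g)"] that by simp
  qed
  obtain h where h: "h \<in> M" "(\<lambda>n. ip_norm ip (s n - h)) \<longlonglongrightarrow> 0"
  proof (rule completeD[OF s(1)])
    fix \<epsilon> :: real assume "\<epsilon> > 0"
    then obtain N where N: "r N < \<epsilon>\<^sup>2 / 4"
      using reals_Archimedean[of "\<epsilon>\<^sup>2 / 4"] by (auto simp: inverse_eq_divide r_def)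
    have "ip_norm ip (s p - s q) < \<epsilon>" if "p \<ge> N" "q \<ge> N" for p q
    proof -
      have "J (s p) - m < \<epsilon>\<^sup>2 / 4" "J (s q) - m < \<epsilon>\<^sup>2 / 4"
        using s(2)[of p] s(2)[of q] N r(2)[OF that(1)] r(2)[OF that(2)] by simp_all
      then have "2 * (J (s p) - m) + 2 * (J (s q) - m) < \<epsilon>\<^sup>2" by argo
      then have "(ip_norm ip (s p - s q))\<^sup>2 < \<epsilon>\<^sup>2"
        by (rule le_less_trans[OF mid[OF s(1)[of p] s(1)[of q]]])
      then show ?thesis using \<open>\<epsilon> > 0\<close> by (simp add: power2_less_imp_less)
    qed
    then show "\<exists>N. \<forall>p\<ge>N. \<forall>q\<ge>N. ip_norm ip (s p - s q) < \<epsilon>" by blast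
  qed (use that in blast)
  have Re: "Re (\<phi> f) = Re (ip h f)" if f: "f \<in> M" for f
  proof -
    define A where "A = Re (ip h f) - Re (\<phi> f)"
    \<comment> \<open>First variation of \<open>J\<close> in the direction \<open>f\<close>. It is
      computed at \<open>s n\<close>, which is within \<open>r n\<close> of the infimum, and then
      passed to the limit by continuity of the inner product.\<close>
    have var: "0 \<le> t\<^sup>2 * (ip_norm ip f)\<^sup>2 + 2 * t * A" for t :: real
    proof -
      have le: "0 \<le> r n + (t\<^sup>2 * (ip_norm ip f)\<^sup>2 + 2 * t * (Re (ip (s n) f) - Re (\<phi> f)))" for n
      proof -
        have "J (s n + cscale (of_real t) f) =
            J (s n) + (t\<^sup>2 * (ip_norm ip f)\<^sup>2 + 2 * t * (Re (ip (s n) f) - Re (\<phi> f)))"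
          using f s(1)[of n] by (simp add: J_def add scale norm_add_sq power_mult_distrib algebra_simps)
        then show ?thesis
          using s(2)[of n] m_le[of "s n + cscale (of_real t) f"] s(1)[of n] f by simp
      qed
      have "(\<lambda>n. ip (s n) f - ip h f) \<longlonglongrightarrow> 0"
      proof (rule Lim_null_comparison)
        show "eventually (\<lambda>n. cmod (ip (s n) f - ip h f) \<le> ip_norm ip (s n - h) * ip_norm ip f) sequentially"
          using cauchy_schwarz[of "s _ - h" f] s(1) h(1) f by (intro always_eventually) simp
        show "(\<lambda>n. ip_norm ip (s n - h) * ip_norm ip f) \<longlonglongrightarrow> 0"
          by (intro tendsto_mult_left_zero h)
      qed
      then have "(\<lambda>n. ip (s n) f) \<longlonglongrightarrow> ip h f" by (rule LIM_zero_cancel)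
      then have "(\<lambda>n. r n + (t\<^sup>2 * (ip_norm ip f)\<^sup>2 + 2 * t * (Re (ip (s n) f) - Re (\<phi> f))))
          \<longlonglongrightarrow> 0 + (t\<^sup>2 * (ip_norm ip f)\<^sup>2 + 2 * t * A)"
        unfolding A_def r_def by (intro tendsto_intros LIMSEQ_Suc[OF lim_1_over_n])
      then show ?thesis using le by (intro LIMSEQ_le_const[of _ "t\<^sup>2 * (ip_norm ip f)\<^sup>2 + 2 * t * A"]) auto
    qed
    \<comment> \<open>The choice t = -A/K makes the linear term dominate; adding 1 keeps the
      denominator positive also for f = 0.\<close>
    define K where "K = (ip_norm ip f)\<^sup>2 + 1"
    have K: "K > 0" by (simp add: K_def add_nonneg_pos)
    have "0 \<le> ((- A / K)\<^sup>2 * (ip_norm ip f)\<^sup>2 + 2 * (- A / K) * A) * K\<^sup>2"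
      using var[of "- A / K"] by simp
    also have "\<dots> = A\<^sup>2 * ((ip_norm ip f)\<^sup>2 - 2 * K)"
      using K by (simp add: field_simps power2_eq_square)
    also have "\<dots> = - (A\<^sup>2 * (K + 1))" by (simp add: K_def algebra_simps)
    finally have "A\<^sup>2 * (K + 1) \<le> 0" by simp
    then have "A = 0" using K by (simp add: mult_le_0_iff)
    then show ?thesis by (simp add: A_def)
  qed
  have "\<phi> f = ip f h" if f: "f \<in> M" for f
    \<comment> \<open>Only real parts have been compared so far; the imaginary parts follow by
      passing from \<open>f\<close> to its multiple by \<open>\<i>\<close>.\<close>
    using Re[OF f] Re[of "cscale \<i> f"] f h(1) by (simp add: scale complex_eq_iff ip_cnj[of h f])
  then show ?thesis using h(1) that by blast
qed

section \<open>Closed subspaces, orthogonal projection and density\<close>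

lemma hilbert_space_on_subset:
  assumes "cfun.subspace S" "S \<subseteq> M"
    and "\<And>s f. (\<And>n. s n \<in> S) \<Longrightarrow> f \<in> M \<Longrightarrow> (\<lambda>n. ip_norm ip (s n - f)) \<longlonglongrightarrow> 0 \<Longrightarrow> f \<in> S"
  shows "hilbert_space_on S ip"
proof -
  have "inner_product_on S ip"
    unfolding inner_product_on_def using assms(2) by (auto simp: subset_iff intro: ip_cnj ip_pos)
  moreover have "complete_on S ip"
    unfolding complete_on_def
  proof (intro allI impI; elim conjE)
    fix s :: "nat \<Rightarrow> complex \<Rightarrow> complex"
    assume s: "\<forall>n. s n \<in> S"
      and Cauchy: "\<forall>\<epsilon>>0. \<exists>N. \<forall>m\<ge>N. \<forall>n\<ge>N. ip_norm ip (s m - s n) < \<epsilon>"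
    from s have "s n \<in> M" for n using assms(2) by blast
    then obtain f where "f \<in> M" "(\<lambda>n. ip_norm ip (s n - f)) \<longlonglongrightarrow> 0"
      using Cauchy completeD by metis
    then show "\<exists>f\<in>S. (\<lambda>n. ip_norm ip (s n - f)) \<longlonglongrightarrow> 0" using assms(3) s by blast
  qed
  ultimately show ?thesis using assms(1) by (simp add: hilbert_space_on_def)
qed

text \<open>The functional \<open>\<lambda>h. ip h f\<close>, restricted to the Hilbert space
  \<open>S\<close>, is represented by a vector of \<open>S\<close>; this vector is the projection of
  \<open>f\<close>.\<close>

lemma projection:
  assumes S: "hilbert_space_on S ip" "S \<subseteq> M" and f: "f \<in> M"
  obtains g where "g \<in> S" "\<And>h. h \<in> S \<Longrightarrow> ip h (f - g) = 0"
proof -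
  interpret S: function_hilbert_space S ip by standard (rule S)
  obtain g where g: "g \<in> S" "\<And>h. h \<in> S \<Longrightarrow> ip h f = ip h g"
  proof (rule S.riesz[of "\<lambda>h. ip h f" "ip_norm ip f"])
    show "cmod (ip h f) \<le> ip_norm ip f * ip_norm ip h" if "h \<in> S" for h
      using cauchy_schwarz[of h f] S f that by (auto simp: mult.commute)
  qed (use S f in \<open>auto simp: subset_iff\<close>)
  have "ip h (f - g) = 0" if "h \<in> S" for h
    using g that S(2) f by (subst ip_diff_right) auto
  then show ?thesis using g(1) that by blast
qed

text \<open>The closure \<open>K\<close> of \<open>S\<close> is a Hilbert space, so every vector of
  \<open>M\<close> has a projection onto it. The remainder is orthogonal to \<open>S\<close>, hence
  zero.\<close>

lemma closure_on_eqI: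
  assumes S: "cfun.subspace S" "S \<subseteq> M"
    and orth: "\<And>f. f \<in> M \<Longrightarrow> (\<And>h. h \<in> S \<Longrightarrow> ip h f = 0) \<Longrightarrow> f = 0"
  shows "closure_on M ip S = M"
proof -
  define K where "K = closure_on M ip S"
  have KM: "K \<subseteq> M" by (auto simp: K_def closure_on_def)
  have SK: "S \<subseteq> K"
  proof
    fix f assume f: "f \<in> S"
    have "\<exists>g\<in>S \<inter> M. ip_norm ip (f - g) < \<epsilon>" if "\<epsilon> > 0" for \<epsilon>
      using f S(2) that by (intro bexI[of _ f]) auto
    then show "f \<in> K" using f S(2) unfolding K_def closure_on_def by blast
  qed
  have K: "\<exists>g\<in>S. ip_norm ip (f - g) < \<epsilon>" if "f \<in> K" "\<epsilon> > 0" for f \<epsilon>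
    using that by (auto simp: K_def closure_on_def)
  have KI: "f \<in> K" if "f \<in> M" "\<And>\<epsilon>. \<epsilon> > 0 \<Longrightarrow> \<exists>g\<in>S. ip_norm ip (f - g) < \<epsilon>" for f
    using that S(2) unfolding K_def closure_on_def by fastforce
  have "cfun.subspace K"
    unfolding cfun.subspace_def
  proof (intro conjI ballI allI)
    show "0 \<in> K" using SK cfun.subspace_0[OF S(1)] by blast
  next
    fix f g assume fg: "f \<in> K" "g \<in> K"
    show "f + g \<in> K"
    proof (rule KI)
      fix \<epsilon> :: real assume "\<epsilon> > 0"
      then obtain f' g' where *: "f' \<in> S" "g' \<in> S" "ip_norm ip (f - f') < \<epsilon> / 2" "ip_norm ip (g - g') < \<epsilon> / 2"
        using K[OF fg(1), of "\<epsilon> / 2"] K[OF fg(2), of "\<epsilon> / 2"] by auto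
      have "f + g - (f' + g') = (f - f') + (g - g')" by simp
      then have "ip_norm ip (f + g - (f' + g')) \<le> ip_norm ip (f - f') + ip_norm ip (g - g')"
        using norm_triangle[of "f - f'" "g - g'"] fg * KM S(2) by (metis closed(3) subsetD)
      then show "\<exists>h\<in>S. ip_norm ip (f + g - h) < \<epsilon>"
        using * cfun.subspace_add[OF S(1) *(1,2)] by (intro bexI[of _ "f' + g'"]) auto
    qed (use closed(2) fg KM in blast)
  next
    fix c f assume f: "f \<in> K"
    show "cscale c f \<in> K"
    proof (rule KI)
      fix \<epsilon> :: real assume "\<epsilon> > 0"
      \<comment> \<open>The summand 1 covers the case c = 0.\<close>
      then obtain g where g: "g \<in> S" "ip_norm ip (f - g) < \<epsilon> / (cmod c + 1)"
        using K[OF f, of "\<epsilon> / (cmod c + 1)"] by (auto simp: add_nonneg_pos)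
      have fg: "f - g \<in> M" using closed(3) f g(1) KM S(2) by blast
      have "ip_norm ip (f - g) * (cmod c + 1) < \<epsilon>"
        using g(2) by (simp add: pos_less_divide_eq add_nonneg_pos)
      then have "cmod c * ip_norm ip (f - g) < \<epsilon>"
        using norm_nonneg[OF fg] by (simp add: algebra_simps)
      moreover have "cscale c f - cscale c g = cscale c (f - g)"
        by (rule cfun.scale_right_diff_distrib[symmetric])
      ultimately have "ip_norm ip (cscale c f - cscale c g) < \<epsilon>" using fg by simp
      then show "\<exists>h\<in>S. ip_norm ip (cscale c f - h) < \<epsilon>"
        using cfun.subspace_scale[OF S(1) g(1)] by blast
    qed (use closed(4) f KM in blast)
  qed
  then have "hilbert_space_on K ip"
  proof (rule hilbert_space_on_subset[OF _ KM])
    fix s f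
    assume s: "\<And>n::nat. s n \<in> K" and f: "f \<in> M" and lim: "(\<lambda>n. ip_norm ip (s n - f)) \<longlonglongrightarrow> 0"
    show "f \<in> K"
    proof (rule KI[OF f])
      fix \<epsilon> :: real assume "\<epsilon> > 0"
      then have "eventually (\<lambda>n. ip_norm ip (s n - f) < \<epsilon> / 2) sequentially"
        by (intro order_tendstoD(2)[OF lim]) simp
      then obtain n where n: "ip_norm ip (s n - f) < \<epsilon> / 2" by (auto simp: eventually_sequentially)
      obtain g where g: "g \<in> S" "ip_norm ip (s n - g) < \<epsilon> / 2"
        using K[OF s[of n], of "\<epsilon> / 2"] \<open>\<epsilon> > 0\<close> by auto
      have "s n \<in> M" "g \<in> M" using s g(1) KM S(2) by blast+
      then have "ip_norm ip (f - g) < \<epsilon>"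
        using norm_triangle_diff[OF f, of "s n" g] norm_minus_commute[OF f, of "s n"] n g(2) by simp
      then show "\<exists>g\<in>S. ip_norm ip (f - g) < \<epsilon>" using g(1) by blast
    qed
  qed
  have "f \<in> K" if f: "f \<in> M" for f
  proof -
    obtain g where g: "g \<in> K" "\<And>h. h \<in> K \<Longrightarrow> ip h (f - g) = 0"
      using projection[OF \<open>hilbert_space_on K ip\<close> KM f] by blast
    have "f - g = 0" by (rule orth) (use f g KM SK in auto)
    then show ?thesis using g(1) by simp
  qed
  then show ?thesis using KM by (auto simp: K_def)
qed

end

subsection \<open>The shift and its wandering subspace\<close>

lemma mult_z_add: "mult_z (f + g) = mult_z f + mult_z g"
  and mult_z_cscale: "mult_z (cscale c f) = cscale c (mult_z f)"
  by (auto simp: mult_z_def cscale_def fun_eq_iff algebra_simps)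

lemma funpow_mult_z_add: "(mult_z ^^ n) (f + g) = (mult_z ^^ n) f + (mult_z ^^ n) g"
  and funpow_mult_z_diff: "(mult_z ^^ n) (f - g) = (mult_z ^^ n) f - (mult_z ^^ n) g"
  and funpow_mult_z_cscale: "(mult_z ^^ n) (cscale c f) = cscale c ((mult_z ^^ n) f)"
  by (auto simp: funpow_mult_z cscale_def fun_eq_iff algebra_simps)

text \<open>Pointwise cancellation of z^n says nothing about the value at 0; comparing Taylor
  coefficients does.\<close>

lemma funpow_mult_z_eq_0D:
  assumes "f \<in> holomorphic_on_disk" "(mult_z ^^ n) f = 0"
  shows "f = 0"
proof (rule holomorphic_on_disk_eqI[OF assms(1) zero_holomorphic_on_disk])
  fix k
  have "taylor_coeff f k = taylor_coeff ((mult_z ^^ n) f) (k + n)"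
    by (simp add: taylor_coeff_funpow_mult_z assms(1))
  then show "taylor_coeff f k = taylor_coeff 0 k" by (simp add: assms(2))
qed

locale shift_invariant_space = function_hilbert_space +
  fixes \<delta> :: real
  assumes sub_hardy2: "M \<subseteq> hardy2"
    and mult_z_closed [simp]: "f \<in> M \<Longrightarrow> mult_z f \<in> M"
    and \<delta>: "\<delta> > 0"
    and lower: "f \<in> M \<Longrightarrow> \<delta> * ip_norm ip f \<le> ip_norm ip (mult_z f)"
    and upper: "f \<in> M \<Longrightarrow> ip_norm ip (mult_z f) \<le> ip_norm ip f"
    and adjoint_condition:
      "n \<ge> 1 \<Longrightarrow> f \<in> M \<Longrightarrow> (adjoint_on M ip mult_z ^^ n) ((mult_z ^^ (n + 1)) f) \<in> mult_z ` M"
begin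

lemma disk: "f \<in> M \<Longrightarrow> f \<in> holomorphic_on_disk"
  using sub_hardy2 hardy2_holomorphic by blast

section \<open>Powers of the shift and of its adjoint\<close>

lemma funpow_closed [simp]: "f \<in> M \<Longrightarrow> (mult_z ^^ n) f \<in> M"
  by (induction n) auto

lemma funpow_lower: "f \<in> M \<Longrightarrow> \<delta> ^ n * ip_norm ip f \<le> ip_norm ip ((mult_z ^^ n) f)"
proof (induction n)
  case (Suc n)
  then have "\<delta> * (\<delta> ^ n * ip_norm ip f) \<le> \<delta> * ip_norm ip ((mult_z ^^ n) f)"
    using \<delta> by (intro mult_left_mono) auto
  also have "\<dots> \<le> ip_norm ip ((mult_z ^^ Suc n) f)" using lower[OF funpow_closed[OF Suc.prems]] by simp
  finally show ?case by (simp add: mult.assoc)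
qed simp

lemma funpow_upper: "f \<in> M \<Longrightarrow> ip_norm ip ((mult_z ^^ n) f) \<le> ip_norm ip f"
proof (induction n)
  case (Suc n)
  then show ?case using upper[OF funpow_closed[OF Suc.prems], of n] by simp
qed simp

text \<open>The description in \<open>adjoint_on\<close> is proper: existence is Riesz
  representation, applicable because the shift is contractive, and uniqueness follows by testing
  with the difference of two candidates.\<close>

lemma adjoint:
  assumes g: "g \<in> M"
  shows "adjoint_on M ip mult_z g \<in> M" "f \<in> M \<Longrightarrow> ip (mult_z f) g = ip f (adjoint_on M ip mult_z g)"
proof -
  obtain h where h: "h \<in> M" "\<And>f. f \<in> M \<Longrightarrow> ip (mult_z f) g = ip f h"
  proof (rule riesz[of "\<lambda>f. ip (mult_z f) g" "ip_norm ip g"])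
    show "cmod (ip (mult_z f) g) \<le> ip_norm ip g * ip_norm ip f" if "f \<in> M" for f
    proof -
      have "cmod (ip (mult_z f) g) \<le> ip_norm ip (mult_z f) * ip_norm ip g"
        using that g by (intro cauchy_schwarz) auto
      also have "\<dots> \<le> ip_norm ip f * ip_norm ip g"
        using that g by (intro mult_right_mono upper) auto
      finally show ?thesis by (simp add: mult.commute)
    qed
  qed (use g in \<open>auto simp: mult_z_add mult_z_cscale\<close>)
  have "\<exists>!h. h \<in> M \<and> (\<forall>f\<in>M. ip (mult_z f) g = ip f h)"
  proof (rule ex1I[of _ h])
    fix h' assume h': "h' \<in> M \<and> (\<forall>f\<in>M. ip (mult_z f) g = ip f h')"
    then have "ip (h' - h) h' = ip (h' - h) h" using h by (metis closed(3))
    then have "ip (h' - h) (h' - h) = 0" using h h' by (subst ip_diff_right) auto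
    then have "ip_norm ip (h' - h) = 0" by (simp add: ip_norm_def)
    then show "h' = h" using h h' by simp
  qed (use h in auto)
  from theI'[OF this]
  show "adjoint_on M ip mult_z g \<in> M" "f \<in> M \<Longrightarrow> ip (mult_z f) g = ip f (adjoint_on M ip mult_z g)"
    unfolding adjoint_on_def by blast+
qed

lemma funpow_adjoint:
  assumes "g \<in> M"
  shows "(adjoint_on M ip mult_z ^^ n) g \<in> M"
    "f \<in> M \<Longrightarrow> ip ((mult_z ^^ n) f) g = ip f ((adjoint_on M ip mult_z ^^ n) g)"
proof -
  show *: "(adjoint_on M ip mult_z ^^ n) g \<in> M" for n
    by (induction n) (use assms adjoint in auto)
  show "f \<in> M \<Longrightarrow> ip ((mult_z ^^ n) f) g = ip f ((adjoint_on M ip mult_z ^^ n) g)"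
  proof (induction n arbitrary: f)
    case (Suc n)
    have "ip ((mult_z ^^ Suc n) f) g = ip ((mult_z ^^ n) (mult_z f)) g" by (simp add: funpow_swap1)
    also have "\<dots> = ip (mult_z f) ((adjoint_on M ip mult_z ^^ n) g)" using Suc by simp
    also have "\<dots> = ip f ((adjoint_on M ip mult_z ^^ Suc n) g)" using adjoint(2)[OF * Suc.prems] by simp
    finally show ?case .
  qed simp
qed

section \<open>Ranges of the powers\<close>

lemma range_subset: "(mult_z ^^ n) ` M \<subseteq> M"
  by auto

lemma subspace_range: "cfun.subspace ((mult_z ^^ n) ` M)"
proof -
  have "0 \<in> (mult_z ^^ n) ` M"
    using closed(1) by (rule rev_image_eqI) (simp add: funpow_mult_z fun_eq_iff)
  then show ?thesis
    unfolding cfun.subspace_def by (auto simp flip: funpow_mult_z_add funpow_mult_z_cscale)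
qed

text \<open>The range is closed because the power is bounded below by \<open>\<delta> ^ n\<close>:
  the preimages of a convergent sequence form a Cauchy sequence, and the power is
  continuous.\<close>

lemma range_limit:
  assumes s: "\<And>k. s k \<in> (mult_z ^^ n) ` M" and f: "f \<in> M"
    and lim: "(\<lambda>k. ip_norm ip (s k - f)) \<longlonglongrightarrow> 0"
  shows "f \<in> (mult_z ^^ n) ` M"
proof -
  obtain u where u: "\<And>k. u k \<in> M" "\<And>k. s k = (mult_z ^^ n) (u k)"
    using s unfolding image_iff by metis
  have sM: "s k \<in> M" for k using u by simp
  obtain g where g: "g \<in> M" "(\<lambda>k. ip_norm ip (u k - g)) \<longlonglongrightarrow> 0"
  proof (rule completeD[OF u(1)])
    fix \<epsilon> :: real assume "\<epsilon> > 0"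
    then obtain N where N: "\<forall>p\<ge>N. \<forall>q\<ge>N. ip_norm ip (s p - s q) < \<delta> ^ n * \<epsilon>"
      using convergent_imp_Cauchy[OF sM f lim, of "\<delta> ^ n * \<epsilon>"] \<delta> by auto
    have "ip_norm ip (u p - u q) < \<epsilon>" if "p \<ge> N" "q \<ge> N" for p q
    proof -
      have "\<delta> ^ n * ip_norm ip (u p - u q) \<le> ip_norm ip (s p - s q)"
        using funpow_lower[of "u p - u q" n] u by (simp add: funpow_mult_z_diff)
      also have "\<dots> < \<delta> ^ n * \<epsilon>" using N that by blast
      finally show ?thesis using \<delta> by simp
    qed
    then show "\<exists>N. \<forall>p\<ge>N. \<forall>q\<ge>N. ip_norm ip (u p - u q) < \<epsilon>" by blast
  qed (use that in blast)
  have "(\<lambda>k. ip_norm ip (s k - (mult_z ^^ n) g)) \<longlonglongrightarrow> 0"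
  proof (rule Lim_null_comparison[OF _ g(2)])
    show "eventually (\<lambda>k. norm (ip_norm ip (s k - (mult_z ^^ n) g)) \<le> ip_norm ip (u k - g)) sequentially"
      using funpow_upper[of "u _ - g" n] u g(1) sM
      by (intro always_eventually) (simp add: funpow_mult_z_diff)
  qed
  then have "f = (mult_z ^^ n) g" by (intro limit_unique[OF sM f _ lim]) (use g in auto)
  then show ?thesis using g by blast
qed

lemma hilbert_space_on_range: "hilbert_space_on ((mult_z ^^ n) ` M) ip"
  by (rule hilbert_space_on_subset[OF subspace_range range_subset range_limit])

text \<open>This is the link between convergence in \<open>M\<close> and Taylor coefficients: a
  limit of elements of the closed range stays in it, so its low coefficients still vanish.\<close>

lemma taylor_coeff_range:
  assumes "f \<in> (mult_z ^^ n) ` M" "k < n"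
  shows "taylor_coeff f k = 0"
  using assms by (auto simp: taylor_coeff_funpow_mult_z disk)

text \<open>Such a function vanishes to infinite order at 0.\<close>

lemma Inter_range:
  assumes "f \<in> M" "\<And>n. f \<in> (mult_z ^^ n) ` M"
  shows "f = 0"
  by (rule holomorphic_on_disk_eqI[OF disk[OF assms(1)] zero_holomorphic_on_disk])
    (use taylor_coeff_range[OF assms(2)] in auto)

section \<open>The wandering subspace\<close>

definition wandering :: "(complex \<Rightarrow> complex) set" where
  "wandering = {e \<in> M. \<forall>f\<in>M. ip (mult_z f) e = 0}"

lemma wandering_orth: "e \<in> wandering \<Longrightarrow> f \<in> M \<Longrightarrow> ip (mult_z f) e = 0"
  by (simp add: wandering_def)

lemma subspace_wandering: "cfun.subspace wandering"
  by (auto simp: cfun.subspace_def wandering_def)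

lemma wandering_in [simp]: "e \<in> wandering \<Longrightarrow> e \<in> M"
  by (simp add: wandering_def)

text \<open>Orthogonal projection onto the range of the shift, which is closed.\<close>

lemma wandering_decomposition:
  assumes f: "f \<in> M"
  obtains e g where "e \<in> wandering" "g \<in> M" "f = e + mult_z g"
proof -
  obtain p where p: "p \<in> (mult_z ^^ 1) ` M" "\<And>h. h \<in> (mult_z ^^ 1) ` M \<Longrightarrow> ip h (f - p) = 0"
    using projection[OF hilbert_space_on_range range_subset f] by blast
  then obtain g where g: "g \<in> M" "p = mult_z g" by auto
  have "ip (mult_z h) (f - p) = 0" if "h \<in> M" for h
    using that by (intro p(2)) auto
  then have "f - p \<in> wandering" using f g by (simp add: wandering_def del: wandering_in)
  then show ?thesis using that[of "f - p" g] g by simp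
qed

text \<open>Moving the \<open>n\<close> shifts away from \<open>e\<close> turns the other vector
  into T*^n T^(n+1) f. By condition (ii) this lies in the range of the shift, to which
  \<open>e\<close> is orthogonal.\<close>

lemma wandering_power_orth:
  assumes e: "e \<in> wandering" and f: "f \<in> M"
  shows "ip ((mult_z ^^ Suc n) f) ((mult_z ^^ n) e) = 0"
proof (cases n)
  \<comment> \<open>Condition (ii) starts at n = 1; for n = 0 the claim is the definition of
    \<open>wandering\<close>.\<close>
  case 0
  then show ?thesis using wandering_orth[OF e f] by simp
next
  case (Suc m)
  let ?g = "(mult_z ^^ Suc n) f"
  obtain k where k: "k \<in> M" "(adjoint_on M ip mult_z ^^ n) ?g = mult_z k"
    using adjoint_condition[of n f] f Suc by auto
  have "ip ((mult_z ^^ n) e) ?g = ip e (mult_z k)"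
    using funpow_adjoint(2)[of ?g e n] e f k by (simp del: funpow.simps)
  also have "\<dots> = 0" using wandering_orth[OF e k(1)] ip_eq_0_sym[of e "mult_z k"] e k by simp
  finally show ?thesis using ip_eq_0_sym[of "(mult_z ^^ n) e" ?g] e f by (simp del: funpow.simps)
qed

lemma wandering_powers_orth:
  assumes "e \<in> wandering" "e' \<in> wandering" "m \<noteq> n"
  shows "ip ((mult_z ^^ m) e) ((mult_z ^^ n) e') = 0"
proof -
  have *: "ip ((mult_z ^^ i) d) ((mult_z ^^ j) d') = 0"
    if "d \<in> M" "d' \<in> wandering" "j < i" for d d' i j
  proof -
    \<comment> \<open>The surplus powers are absorbed into the vector of \<open>M\<close>, which
      need not be wandering.\<close>
    have "(mult_z ^^ i) d = (mult_z ^^ Suc j) ((mult_z ^^ (i - Suc j)) d)"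
      using \<open>j < i\<close> by (simp del: funpow.simps flip: funpow_add comp_apply[of "mult_z ^^ _"])
    then show ?thesis using wandering_power_orth[OF that(2), of "(mult_z ^^ (i - Suc j)) d" j] that(1) by simp
  qed
  show ?thesis
  proof (cases "m < n")
    case True
    then show ?thesis using *[of e' e m n] ip_eq_0_sym assms by simp
  next
    case False
    then show ?thesis using *[of e e' n m] assms by simp
  qed
qed

section \<open>Expansions along the powers of the shift\<close>

definition psum :: "(complex \<Rightarrow> complex) \<Rightarrow> (complex \<Rightarrow> complex) \<Rightarrow> nat \<Rightarrow> (complex \<Rightarrow> complex)" where
  "psum e f n = (\<Sum>k<n. cscale (taylor_coeff f k) ((mult_z ^^ k) e))"

lemma psum_closed [simp]: "e \<in> M \<Longrightarrow> psum e f n \<in> M"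
  by (simp add: psum_def)

lemma psum_Suc: "psum e f (Suc n) = psum e f n + cscale (taylor_coeff f n) ((mult_z ^^ n) e)"
  by (simp add: psum_def)

lemma psum_diff:
  assumes "n \<le> m"
  shows "psum e f m - psum e f n = (\<Sum>k\<in>{n..<m}. cscale (taylor_coeff f k) ((mult_z ^^ k) e))"
  unfolding psum_def lessThan_atLeast0 using assms by (intro sum_diff_nat_ivl) auto

text \<open>The vectors T^k e are orthogonal, and their norms are at most that of \<open>e\<close>
  because the shift is contractive.\<close>

lemma norm_psum_diff_le:
  assumes e: "e \<in> wandering" and nm: "n \<le> m"
  shows "(ip_norm ip (psum e f m - psum e f n))\<^sup>2 \<le> (\<Sum>k=n..<m. (cmod (taylor_coeff f k))\<^sup>2) * (ip_norm ip e)\<^sup>2"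
proof -
  let ?x = "\<lambda>k. cscale (taylor_coeff f k) ((mult_z ^^ k) e)"
  have "(ip_norm ip (psum e f m - psum e f n))\<^sup>2 = (\<Sum>k=n..<m. (ip_norm ip (?x k))\<^sup>2)"
    unfolding psum_diff[OF nm]
    by (rule pythagoras) (use e in \<open>auto simp: wandering_powers_orth\<close>)
  also have "\<dots> \<le> (\<Sum>k=n..<m. (cmod (taylor_coeff f k))\<^sup>2 * (ip_norm ip e)\<^sup>2)"
    using e funpow_upper[of e] by (intro sum_mono) (auto simp: power_mult_distrib intro!: mult_left_mono power_mono)
  finally show ?thesis by (simp add: sum_distrib_right)
qed

lemma taylor_coeff_psum:
  assumes "e \<in> M"
  shows "taylor_coeff (psum e f n) k =
    (\<Sum>i<n. taylor_coeff f i * (if k < i then 0 else taylor_coeff e (k - i)))"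
proof (induction n)
  case 0
  have "taylor_coeff (psum e f 0) k = 0" by (simp add: psum_def)
  then show ?case by simp
next
  case (Suc n)
  have "taylor_coeff (psum e f (Suc n)) k = taylor_coeff (psum e f n) k +
      taylor_coeff f n * (if k < n then 0 else taylor_coeff e (k - n))"
    unfolding psum_Suc using assms
    by (subst taylor_coeff_add) (auto simp: disk taylor_coeff_cscale taylor_coeff_funpow_mult_z)
  then show ?case by (simp add: Suc)
qed

text \<open>The partial sums form a Cauchy sequence in \<open>M\<close>. Their limit is identified
  with \<open>e * f\<close> coefficient by coefficient, since each remainder lies in the range of a
  power and so has no low coefficients. The second claim is kept for comparing two expansions modulo
  such a range.\<close>

lemma psum_limit:
  assumes e: "e \<in> wandering" and f: "f \<in> hardy2"
  shows "e * f \<in> M" "e * f - psum e f n \<in> (mult_z ^^ n) ` M"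
    "ip_norm ip (e * f) \<le> hardy2_norm f * ip_norm ip e"
proof -
  let ?a = "\<lambda>k. (cmod (taylor_coeff f k))\<^sup>2"
  have eM: "e \<in> M" using e by simp
  have sumf: "summable ?a" using f by (simp add: hardy2_def)
  obtain g where g: "g \<in> M" "(\<lambda>n. ip_norm ip (psum e f n - g)) \<longlonglongrightarrow> 0"
  proof (rule completeD)
    show "psum e f n \<in> M" for n using eM by simp
    fix \<epsilon> :: real assume "\<epsilon> > 0"
    define c where "c = \<epsilon>\<^sup>2 / ((ip_norm ip e)\<^sup>2 + 1)"
    have pos: "(ip_norm ip e)\<^sup>2 + 1 > 0" by (simp add: add_nonneg_pos)
    then have "c > 0" using \<open>\<epsilon> > 0\<close> by (simp add: c_def)
    then obtain N where N: "\<And>m n. m \<ge> N \<Longrightarrow> norm (sum ?a {m..<n}) < c"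
      using sumf unfolding summable_Cauchy by blast
    have *: "ip_norm ip (psum e f m - psum e f n) < \<epsilon>" if "N \<le> n" "n \<le> m" for m n
    proof -
      have "(ip_norm ip (psum e f m - psum e f n))\<^sup>2 \<le> sum ?a {n..<m} * (ip_norm ip e)\<^sup>2"
        by (rule norm_psum_diff_le[OF e that(2)])
      also have "\<dots> \<le> c * (ip_norm ip e)\<^sup>2"
        using N[OF that(1), of m] by (intro mult_right_mono) auto
      also have "\<dots> < c * ((ip_norm ip e)\<^sup>2 + 1)" using \<open>c > 0\<close> by simp
      also have "\<dots> = \<epsilon>\<^sup>2" using pos by (simp add: c_def)
      finally show ?thesis using \<open>\<epsilon> > 0\<close> by (simp add: power2_less_imp_less)
    qed
    have "ip_norm ip (psum e f m - psum e f n) < \<epsilon>" if "m \<ge> N" "n \<ge> N" for m n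
      using *[of n m] *[of m n] that norm_minus_commute[of "psum e f m" "psum e f n"] eM
      by (cases "n \<le> m") auto
    then show "\<exists>N. \<forall>m\<ge>N. \<forall>n\<ge>N. ip_norm ip (psum e f m - psum e f n) < \<epsilon>" by blast
  qed (use that in blast)
  \<comment> \<open>The remainder is a limit of finite sums of terms with k \<ge> n, all of which
    lie in the closed range of T^n.\<close>
  have range: "g - psum e f n \<in> (mult_z ^^ n) ` M" for n
  proof (rule range_limit)
    show "psum e f (n + j) - psum e f n \<in> (mult_z ^^ n) ` M" for j
      unfolding psum_diff[OF le_add1]
    proof (rule cfun.subspace_sum[OF subspace_range], rule cfun.subspace_scale[OF subspace_range])
      fix k assume "k \<in> {n..<n + j}"
      then have "(mult_z ^^ k) e = (mult_z ^^ n) ((mult_z ^^ (k - n)) e)"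
        by (simp flip: funpow_add comp_apply[of "mult_z ^^ _"])
      then show "(mult_z ^^ k) e \<in> (mult_z ^^ n) ` M"
        by (rule image_eqI[of _ "mult_z ^^ n"]) (use eM in simp)
    qed
    have "(\<lambda>j. ip_norm ip (psum e f (j + n) - g)) \<longlonglongrightarrow> 0"
      by (rule LIMSEQ_ignore_initial_segment[OF g(2)])
    then show "(\<lambda>j. ip_norm ip (psum e f (n + j) - psum e f n - (g - psum e f n))) \<longlonglongrightarrow> 0"
      by (simp add: add.commute)
  qed (use g eM in simp)
  have D: "e \<in> holomorphic_on_disk" "f \<in> holomorphic_on_disk"
    using disk[OF eM] hardy2_holomorphic[OF f] .
  have "g = e * f"
  proof (rule holomorphic_on_disk_eqI)
    fix k
    \<comment> \<open>With \<open>Suc k\<close> terms the remainder vanishes to order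
      \<open>Suc k\<close>, so coefficient \<open>k\<close> of the partial sum is already that of
      the limit.\<close>
    have "taylor_coeff g k - taylor_coeff (psum e f (Suc k)) k = 0"
      using taylor_coeff_range[OF range, of k "Suc k"] g(1) eM by (simp add: taylor_coeff_diff disk)
    then have "taylor_coeff g k = (\<Sum>i<Suc k. taylor_coeff f i * taylor_coeff e (k - i))"
      by (simp add: taylor_coeff_psum[OF eM] less_Suc_eq_le cong: sum.cong_simp)
    also have "\<dots> = taylor_coeff (f * e) k"
      by (simp add: taylor_coeff_mult D atLeast0AtMost lessThan_Suc_atMost)
    finally show "taylor_coeff g k = taylor_coeff (e * f) k" by (simp add: mult.commute)
  qed (use g disk D holomorphic_on_disk_closed in auto)
  then show "e * f \<in> M" "e * f - psum e f n \<in> (mult_z ^^ n) ` M" using g range by auto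
  have bound: "ip_norm ip (psum e f n) \<le> hardy2_norm f * ip_norm ip e" for n
  proof (rule power2_le_imp_le)
    have "(ip_norm ip (psum e f n))\<^sup>2 \<le> sum ?a {0..<n} * (ip_norm ip e)\<^sup>2"
      using norm_psum_diff_le[OF e, of 0 n f] by (simp add: psum_def)
    also have "\<dots> \<le> (\<Sum>k. ?a k) * (ip_norm ip e)\<^sup>2"
      by (intro mult_right_mono sum_le_suminf sumf) auto
    also have "\<dots> = (hardy2_norm f * ip_norm ip e)\<^sup>2"
      using suminf_nonneg[OF sumf] by (simp add: hardy2_norm_def power_mult_distrib)
    finally show "(ip_norm ip (psum e f n))\<^sup>2 \<le> (hardy2_norm f * ip_norm ip e)\<^sup>2" .
    show "0 \<le> hardy2_norm f * ip_norm ip e"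
      using suminf_nonneg[OF sumf] eM by (simp add: hardy2_norm_def)
  qed
  have "ip_norm ip g \<le> ip_norm ip (psum e f n - g) + hardy2_norm f * ip_norm ip e" for n
    using norm_triangle[of "g - psum e f n" "psum e f n"] bound[of n] g(1) eM
      norm_minus_commute[of g "psum e f n"] by simp
  moreover have "(\<lambda>n. ip_norm ip (psum e f n - g) + hardy2_norm f * ip_norm ip e)
      \<longlonglongrightarrow> 0 + hardy2_norm f * ip_norm ip e"
    by (intro tendsto_intros g)
  ultimately have "ip_norm ip g \<le> 0 + hardy2_norm f * ip_norm ip e"
    by (intro LIMSEQ_le_const) auto
  then show "ip_norm ip (e * f) \<le> hardy2_norm f * ip_norm ip e" using \<open>g = e * f\<close> by simp
qed

text \<open>The product \<open>e * e'\<close> expands both along the powers of the shift applied to \<open>e\<close> and along those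
  applied to \<open>e'\<close>; comparing the two expansions shows that \<open>e\<close> and \<open>e'\<close> are proportional.\<close>

lemma wandering_proportional:
  assumes e: "e \<in> wandering" and e': "e' \<in> wandering" and nz: "e' \<noteq> 0"
  obtains c where "e = cscale c e'"
proof -
  \<comment> \<open>The difference of the two expansions has T^k applied to \<open>?u k\<close> as
    its term of index \<open>k\<close>; the aim is to show that all \<open>?u k\<close>
    vanish.\<close>
  let ?u = "\<lambda>k. cscale (taylor_coeff e' k) e - cscale (taylor_coeff e k) e'"
  have eM: "e \<in> M" "e' \<in> M" using e e' by auto
  have u: "?u k \<in> wandering" for k
    by (intro cfun.subspace_diff cfun.subspace_scale subspace_wandering e e')
  have h: "e \<in> hardy2" "e' \<in> hardy2" using eM sub_hardy2 by auto
  have u0: "?u n = 0" for n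
  proof (induction n rule: less_induct)
    case (less n)
    have "psum e e' (Suc n) - psum e' e (Suc n) = (\<Sum>k<Suc n. (mult_z ^^ k) (?u k))"
      by (simp only: psum_def sum_subtractf[symmetric] funpow_mult_z_diff funpow_mult_z_cscale)
    also have "\<dots> = (mult_z ^^ n) (?u n)"
    proof -
      have "(\<Sum>k<n. (mult_z ^^ k) (?u k)) = 0"
        using less by (intro sum.neutral) (auto simp: funpow_mult_z fun_eq_iff)
      then show ?thesis unfolding sum.lessThan_Suc by simp
    qed
    \<comment> \<open>Both partial sums differ from the same product by an element of the range of
      T^(n+1), so T^n applied to \<open>?u n\<close> lies in that range. It is also orthogonal to
      it, hence zero.\<close>
    finally have "(mult_z ^^ n) (?u n) = (e' * e - psum e' e (Suc n)) - (e * e' - psum e e' (Suc n))"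
      by (simp add: mult.commute)
    then have "(mult_z ^^ n) (?u n) \<in> (mult_z ^^ Suc n) ` M"
      using cfun.subspace_diff[OF subspace_range psum_limit(2)[OF e' h(1)] psum_limit(2)[OF e h(2)]]
      by metis
    then obtain v where v: "v \<in> M" "(mult_z ^^ n) (?u n) = (mult_z ^^ Suc n) v" by blast
    have "ip ((mult_z ^^ Suc n) v) ((mult_z ^^ n) (?u n)) = 0"
      by (rule wandering_power_orth[OF u v(1)])
    then have "ip_norm ip ((mult_z ^^ n) (?u n)) = 0" using v(2) by (simp add: ip_norm_def)
    moreover have uM: "?u n \<in> M" using u by simp
    ultimately have "(mult_z ^^ n) (?u n) = 0" by (simp only: norm_eq_0_iff funpow_closed)
    then show ?case by (rule funpow_mult_z_eq_0D[OF disk[OF uM]])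
  qed
  obtain k where k: "taylor_coeff e' k \<noteq> 0"
    using holomorphic_on_disk_eqI[OF disk[OF eM(2)] zero_holomorphic_on_disk] nz by auto
  have "cscale (taylor_coeff e' k) e = cscale (taylor_coeff e k) e'" using u0[of k] by simp
  then have "e = cscale (taylor_coeff e k / taylor_coeff e' k) e'"
    using k by (simp add: cscale_def fun_eq_iff field_simps)
  then show ?thesis by (rule that)
qed

text \<open>If 0 were the only wandering vector, the decomposition would make the shift surjective
  on \<open>M\<close>. Every element would then lie in the range of every power and be zero.\<close>

lemma wandering_nonzero:
  assumes "M \<noteq> {0}"
  obtains e where "e \<in> wandering" "ip_norm ip e = 1"
proof -
  have "\<exists>e\<in>wandering. e \<noteq> 0"
  proof (rule ccontr)
    assume "\<not> ?thesis"
    then have *: "\<exists>g\<in>M. f = mult_z g" if "f \<in> M" for f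
      using wandering_decomposition[OF that] by (metis add_0)
    have "f \<in> (mult_z ^^ n) ` M" if "f \<in> M" for f n
      using that
    proof (induction n arbitrary: f)
      case (Suc n)
      obtain g where g: "g \<in> M" "f = mult_z g" using *[OF Suc.prems] by blast
      then obtain h where "h \<in> M" "g = (mult_z ^^ n) h" using Suc.IH[of g] by blast
      then show ?case using g by auto
    qed simp
    then have "\<forall>f\<in>M. f = 0" using Inter_range by blast
    then show False using assms closed(1) by blast
  qed
  then obtain e where e: "e \<in> wandering" "e \<noteq> 0" by blast
  have "cscale (of_real (1 / ip_norm ip e)) e \<in> wandering"
    by (rule cfun.subspace_scale[OF subspace_wandering e(1)])
  moreover have "ip_norm ip (cscale (of_real (1 / ip_norm ip e)) e) = 1"
    using norm_pos[OF wandering_in[OF e(1)] e(2)] e(1) by (subst norm_cscale) (auto simp: norm_divide)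
  ultimately show ?thesis by (rule that)
qed

text \<open>By induction \<open>f\<close> lies in the range of every power. If f = T^n g, the
  wandering component of \<open>g\<close> is a multiple of \<open>e\<close>, and orthogonality of
  \<open>f\<close> to T^n e makes this component vanish.\<close>

lemma orthogonal_to_powers:
  assumes e: "e \<in> wandering" "e \<noteq> 0" and f: "f \<in> M" and orth: "\<And>n. ip ((mult_z ^^ n) e) f = 0"
  shows "f = 0"
proof (rule Inter_range[OF f])
  show "f \<in> (mult_z ^^ n) ` M" for n
  proof (induction n)
    case 0
    then show ?case using f by simp
  next
    case (Suc n)
    have eM: "e \<in> M" using e by simp
    obtain g where g: "g \<in> M" "f = (mult_z ^^ n) g" using Suc by blast
    obtain d g' where d: "d \<in> wandering" "g' \<in> M" "g = d + mult_z g'"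
      using wandering_decomposition[OF g(1)] .
    obtain c where c: "d = cscale c e" using wandering_proportional[OF d(1) e] .
    have f_eq: "f = cscale c ((mult_z ^^ n) e) + (mult_z ^^ Suc n) g'"
      unfolding g(2) d(3) c funpow_mult_z_add funpow_mult_z_cscale funpow_Suc_right by simp
    have "ip ((mult_z ^^ n) e) ((mult_z ^^ Suc n) g') = 0"
      using wandering_power_orth[OF e(1) d(2), of n]
        ip_eq_0_sym[OF funpow_closed[OF eM] funpow_closed[OF d(2)], of n "Suc n"] by blast
    then have "cnj c * ip ((mult_z ^^ n) e) ((mult_z ^^ n) e) = 0"
      using orth[of n] eM d(2) unfolding f_eq by (subst (asm) ip_add_right) (auto simp del: funpow.simps)
    moreover have "ip ((mult_z ^^ n) e) ((mult_z ^^ n) e) \<noteq> 0"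
      using ip_pos[of "(mult_z ^^ n) e"] eM funpow_mult_z_eq_0D[OF disk[OF eM]] e(2) by fastforce
    ultimately have "c = 0" by simp
    then show ?case unfolding f_eq using d(2) by simp
  qed
qed

end

section \<open>The weighted shift and the density of the multiples\<close>

lemma monomial_hardy2:
  obtains p where "p \<in> hardy2" "\<And>e. e \<in> holomorphic_on_disk \<Longrightarrow> e * p = (mult_z ^^ n) e"
proof -
  \<comment> \<open>The constant 1 in the chosen representation, extended by 0 outside the disk; the
    monomial is T^n u.\<close>
  define u :: "complex \<Rightarrow> complex" where "u = (\<lambda>z. if z \<in> ball 0 1 then 1 else 0)"
  have "u holomorphic_on ball 0 1 \<longleftrightarrow> (\<lambda>_. 1) holomorphic_on ball 0 1"
    by (intro holomorphic_cong) (auto simp: u_def)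
  then have u: "u \<in> holomorphic_on_disk" by (simp add: holomorphic_on_disk_def u_def)
  have "eventually (\<lambda>z::complex. z \<in> ball 0 1) (nhds 0)"
    by (rule eventually_nhds_in_open) auto
  then have "eventually (\<lambda>z. 1 = u z) (nhds 0)"
    by eventually_elim (simp add: u_def)
  then have "u has_fps_expansion 1"
    using has_fps_expansion_cong[of "\<lambda>_. 1" u 1 1] by simp
  then have "taylor_coeff u k = (if k = 0 then 1 else 0)" for k
    by (simp add: taylor_coeff_eqI)
  then have "(cmod (taylor_coeff ((mult_z ^^ n) u) k))\<^sup>2 = (if k = n then 1 else 0)" for k
    by (simp add: taylor_coeff_funpow_mult_z u)
  then have "(mult_z ^^ n) u \<in> hardy2"
    by (simp add: hardy2_def funpow_mult_z_holomorphic u)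
  moreover have "e * (mult_z ^^ n) u = (mult_z ^^ n) e" if "e \<in> holomorphic_on_disk" for e
    using that by (auto simp: funpow_mult_z u_def fun_eq_iff holomorphic_on_disk_def)
  ultimately show ?thesis by (rule that)
qed

context shift_invariant_space
begin

text \<open>The basis consists of the normalised vectors T^n e, and the weights are the quotients of
  consecutive norms, at most 1 by contractivity. Density of the span comes from
  \<open>orthogonal_to_powers\<close>.\<close>

lemma weighted_shift:
  assumes e: "e \<in> wandering" "e \<noteq> 0"
  shows "weighted_shift_on M ip mult_z"
proof -
  have eM: "e \<in> M" using e by simp
  define N where "N n = ip_norm ip ((mult_z ^^ n) e)" for n
  have N: "N n > 0" for n
    unfolding N_def using eM e(2) funpow_mult_z_eq_0D[OF disk[OF eM], of n] by (intro norm_pos) auto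
  define b where "b n = cscale (of_real (1 / N n)) ((mult_z ^^ n) e)" for n
  have bM: "b n \<in> M" for n using eM by (simp add: b_def)
  have b_inv: "(mult_z ^^ n) e = cscale (of_real (N n)) (b n)" for n
    using N[of n] by (simp add: b_def cscale_def fun_eq_iff)
  have orthonormal: "ip (b m) (b n) = (if m = n then 1 else 0)" for m n
  proof (cases "m = n")
    case True
    have "ip ((mult_z ^^ n) e) ((mult_z ^^ n) e) = of_real ((N n)\<^sup>2)"
      using ip_self[OF funpow_closed[OF eM], of n] by (simp add: N_def)
    then show ?thesis using True eM N[of n] by (simp add: b_def power2_eq_square)
  next
    case False
    then show ?thesis using wandering_powers_orth[OF e(1) e(1) False] eM by (simp add: b_def)
  qed
  have "closure_on M ip (cfun.span (range b)) = M"
  proof (rule closure_on_eqI[OF cfun.subspace_span])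
    show "cfun.span (range b) \<subseteq> M"
      by (rule cfun.span_minimal[OF _ subspace]) (use bM in auto)
    fix f assume f: "f \<in> M" "\<And>h. h \<in> cfun.span (range b) \<Longrightarrow> ip h f = 0"
    have "ip ((mult_z ^^ n) e) f = 0" for n
      unfolding b_inv by (intro f(2) cfun.span_scale cfun.span_base) simp
    then show "f = 0" by (rule orthogonal_to_powers[OF e f(1)])
  qed
  then have basis: "orthonormal_basis_on M ip b"
    using bM orthonormal by (simp add: orthonormal_basis_on_def)
  define w where "w n = N (Suc n) / N n" for n
  have wpos: "w n > 0" for n using N by (simp add: w_def)
  have "w n \<le> 1" for n
    using upper[OF funpow_closed[OF eM], of n] N[of n] by (simp add: w_def N_def)
  then have "bounded (range w)"
    using wpos by (auto simp: bounded_iff less_imp_le intro!: exI[of _ 1])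
  moreover have "mult_z (b n) = cscale (of_real (w n)) (b (Suc n))" for n
    using N[of "Suc n"] by (simp add: b_def w_def mult_z_cscale)
  moreover have "bounded_operator_on M ip mult_z"
    unfolding bounded_operator_on_def
    using upper by (auto simp: mult_z_add mult_z_cscale intro!: exI[of _ 1])
  ultimately show ?thesis using basis wpos unfolding weighted_shift_on_def by blast
qed

text \<open>Multiplying \<open>e\<close> by monomials gives all T^n e, so only 0 is orthogonal to
  the multiples of \<open>e\<close>.\<close>

lemma closure_multiples:
  assumes e: "e \<in> wandering" "e \<noteq> 0"
  shows "closure_on M ip ((\<lambda>f. e * f) ` hardy2) = M"
proof (rule closure_on_eqI)
  have "cscale c (e * f) = e * cscale c f" for c f
    by (simp add: cscale_def fun_eq_iff)
  then show "cfun.subspace ((\<lambda>f. e * f) ` hardy2)"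
    using cfun.subspace_0[OF subspace_hardy2] hardy2_add(1) hardy2_cscale(1)
    unfolding cfun.subspace_def by (auto simp flip: distrib_left intro!: rev_image_eqI[of 0])
  show "(\<lambda>f. e * f) ` hardy2 \<subseteq> M" using psum_limit(1)[OF e(1)] by blast
  fix f assume f: "f \<in> M" "\<And>h. h \<in> (\<lambda>f. e * f) ` hardy2 \<Longrightarrow> ip h f = 0"
  have "(mult_z ^^ n) e \<in> (\<lambda>f. e * f) ` hardy2" for n
    using monomial_hardy2[of n] disk[OF wandering_in[OF e(1)]] by (metis imageI)
  then show "f = 0" by (rule orthogonal_to_powers[OF e f(1) f(2)])
qed

end

theorem theorem3p1:
  fixes M :: "(complex \<Rightarrow> complex) set"
    and ip :: "(complex \<Rightarrow> complex) \<Rightarrow> (complex \<Rightarrow> complex) \<Rightarrow> complex"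
  assumes "hilbert_space_on M ip"
    and "M \<noteq> {0}"
    and "M \<subseteq> hardy2"
    and "mult_z ` M \<subseteq> M"
    and "\<exists>\<delta>>0. \<forall>f\<in>M. \<delta> * ip_norm ip f \<le> ip_norm ip (mult_z f) \<and>
                          ip_norm ip (mult_z f) \<le> ip_norm ip f"
    and "\<forall>n::nat. n \<ge> 1 \<longrightarrow>
           ((adjoint_on M ip mult_z ^^ n) \<circ> (mult_z ^^ (n + 1))) ` M \<subseteq> mult_z ` M"
  shows "weighted_shift_on M ip mult_z \<and>
         (\<exists>b\<in>hardy_inf.
            (\<lambda>f. b * f) ` hardy2 \<subseteq> M \<and>
            M = closure_on M ip ((\<lambda>f. b * f) ` hardy2) \<and>
            (\<forall>f\<in>hardy2. ip_norm ip (b * f) \<le> hardy2_norm f))"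
proof -
  obtain \<delta> where \<delta>: "\<delta> > 0" "\<And>f. f \<in> M \<Longrightarrow> \<delta> * ip_norm ip f \<le> ip_norm ip (mult_z f)"
      "\<And>f. f \<in> M \<Longrightarrow> ip_norm ip (mult_z f) \<le> ip_norm ip f"
    using assms(5) by blast
  interpret shift_invariant_space M ip \<delta>
  proof unfold_locales
    fix n f assume "1 \<le> (n::nat)" "f \<in> M"
    then have "((adjoint_on M ip mult_z ^^ n) \<circ> (mult_z ^^ (n + 1))) f \<in> mult_z ` M"
      using assms(6) by blast
    then show "(adjoint_on M ip mult_z ^^ n) ((mult_z ^^ (n + 1)) f) \<in> mult_z ` M" by simp
  qed (use assms \<delta> in auto)
  \<comment> \<open>This vector serves as \<open>b\<close>; its norm 1 gives the constant 1 in the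
    final estimate.\<close>
  obtain e where e: "e \<in> wandering" "ip_norm ip e = 1"
    using wandering_nonzero[OF assms(2)] .
  have e0: "e \<noteq> 0" using e(2) by auto
  have mem: "e * f \<in> M" if "f \<in> hardy2" for f using psum_limit(1)[OF e(1) that] .
  \<comment> \<open>Multiplication by \<open>e\<close> maps the Hardy space into \<open>M\<close>,
    hence into itself.\<close>
  have "e \<in> hardy_inf"
    by (rule hardy2_multiplier_bounded) (use disk mem sub_hardy2 e(1) in auto)
  moreover have "ip_norm ip (e * f) \<le> hardy2_norm f" if "f \<in> hardy2" for f
    using psum_limit(3)[OF e(1) that] e(2) by simp
  ultimately show ?thesis
    using weighted_shift[OF e(1) e0] closure_multiples[OF e(1) e0] mem
    by (intro conjI bexI[of _ e]) auto
qed

end
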